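(* Let $N\ge1$ and let $\mathcal S_1,\dots,\mathcal S_t$ be pairwise disjoint subsets of $[N]$ with $|\mathcal S_j|=\ell_j$ and $\ell=\sum_j\ell_j$. Let $\sigma=p_1p_2$, where $p_1,p_2$ are independent, each uniformly random among the $(N-1)!$ cycles of length $N$ in $S_N$, and let $p(N,\vec\ell;2)$ be the probability that no cycle of $\sigma$ contains elements from two different sets $\mathcal S_i,\mathcal S_j$ ($i\ne j$). Then \[ p(N,\vec\ell;2)=\frac{(N-\ell)!\prod_j\ell_j!}{(N-1)!\,(N+t)}\left[(-1)^{N+\ell}\frac{\binom{N-1}{t-2}}{\binom{N+\ell}{\ell-t}}+\frac{(N+t)(N+1)_{\ell+1}}{(N-t+1)(N+\ell)!\,(\ell)_t}\sum_{\nu=0}^{\ell-t}\frac{(N+\ell-\nu-1)!\,(N-1)_\nu}{(\ell-t-\nu)!\,(N-t)_\nu}\right]. \]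
   Context: $(a)_b=a(a-1)\cdots(a-b+1)$ denotes the falling factorial, with $(a)_0=1$.
   Formalization: The sets S_j are assumed nonempty: with empty sets the formula fails (N=2, t=2, S_1={1,2}, S_2=∅ gives 2 while the probability is 1) or is undefined, since (ℓ)_t=0 when ℓ<t. *)

theory Defs
  imports "HOL-Combinatorics.Combinatorics" "HOL-Probability.Probability"
begin

definition falling_factorial :: "real \<Rightarrow> nat \<Rightarrow> real" where
  "falling_factorial a b = (\<Prod>i<b. a - real i)"

text \<open>Binomial coefficient with an integer lower index, zero if that index is negative.
  On \<^typ>\<open>nat\<close>, the expression \<open>t - 2\<close> would be truncated to \<open>0\<close> for \<open>t < 2\<close> and the
  binomial coefficient would wrongly become \<open>1\<close>.\<close>

definition int_binomial :: "nat \<Rightarrow> int \<Rightarrow> nat" where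
  "int_binomial n k = (if k < 0 then 0 else n choose nat k)"

text \<open>For \<open>N = 1\<close> the only cycle of length \<open>N\<close> is the identity.\<close>

definition full_cycles :: "nat \<Rightarrow> (nat \<Rightarrow> nat) set" where
  "full_cycles N = {p. p permutes {1..N} \<and> cyclic_on p {1..N}}"

text \<open>The cycles of \<open>\<sigma>\<close> are its orbits on \<open>{1..N}\<close>; fixed points count as cycles of length 1.\<close>

definition separates :: "nat \<Rightarrow> nat \<Rightarrow> (nat \<Rightarrow> nat set) \<Rightarrow> (nat \<Rightarrow> nat) \<Rightarrow> bool" where
  "separates N t S \<sigma> \<longleftrightarrow>
     (\<forall>x\<in>{1..N}. \<not> (\<exists>i\<in>{1..t}. \<exists>j\<in>{1..t}. i \<noteq> j \<and>
        orbit \<sigma> x \<inter> S i \<noteq> {} \<and> orbit \<sigma> x \<inter> S j \<noteq> {}))"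

text \<open>\<^const>\<open>pair_pmf\<close> is the product distribution, so \<open>p\<^sub>1\<close> and \<open>p\<^sub>2\<close> are independent.\<close>

definition separation_prob :: "nat \<Rightarrow> nat \<Rightarrow> (nat \<Rightarrow> nat set) \<Rightarrow> real" where
  "separation_prob N t S =
     measure_pmf.prob (pair_pmf (pmf_of_set (full_cycles N)) (pmf_of_set (full_cycles N)))
       {(p\<^sub>1, p\<^sub>2). separates N t S (p\<^sub>1 \<circ> p\<^sub>2)}"

end

theory Submission
  imports Defs
begin

text \<open>
  Colour the cycles of \<open>\<sigma> = p\<^sub>1 p\<^sub>2\<close> with \<open>q\<close> colours so that the elements of \<open>S\<^sub>j\<close> receive
  colour \<open>j\<close>. If \<open>\<sigma>\<close> separates the sets there are \<open>q\<^sup>f\<close> such colourings, where \<open>f\<close> is the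
  number of cycles avoiding all \<open>S\<^sub>j\<close>; otherwise there are none. The number of all triples
  \<open>(p\<^sub>1, p\<^sub>2, colouring)\<close> is therefore a polynomial in \<open>q\<close> (known at all integers \<open>q \<ge> t\<close>)
  whose value at \<open>q = 1\<close> is the number of separating pairs.

  For a fixed colouring with \<open>k\<close> nonempty classes of sizes \<open>n\<^sub>i\<close>, the number of pairs of full cycles
  whose product preserves the colour of every element is \<open>(N - 1)! \<Prod>\<^sub>i n\<^sub>i! / (N - k + 1)\<close>.
  Indeed, given \<open>p\<close>, the full cycles \<open>\<pi>\<close> inducing the same successor colours as \<open>p\<close> are Eulerian tours
  of a digraph on the colours, hence are counted by spanning trees as in the BEST theorem; and for
  a fixed choice of one outgoing arc per non-root colour, the probability over random \<open>p\<close> that these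
  arcs form a tree follows by contracting one arc at a time.

  The resulting alternating sum and the asserted closed form satisfy the same first-order
  recurrence in \<open>\<ell>\<close>, starting at \<open>\<ell> = t\<close>.
\<close>

section \<open>Cycles and trees\<close>

definition cycles_on :: "'a set \<Rightarrow> ('a \<Rightarrow> 'a) set" where
  "cycles_on X = {p. p permutes X \<and> cyclic_on p X}"

text \<open>An orbit is the least closed set through its starting point, so transitivity can be
  tested on closed subsets. This form survives cutting and inserting points without computing
  orbits.\<close>

lemma cyclic_on_iff_closed:
  assumes "p permutes X"
  shows "cyclic_on p X \<longleftrightarrow> X \<noteq> {} \<and> (\<forall>Y\<subseteq>X. Y \<noteq> {} \<longrightarrow> p ` Y \<subseteq> Y \<longrightarrow> Y = X)"
proof
  assume cyc: "cyclic_on p X"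
  have "Y = X" if Y: "Y \<subseteq> X" "Y \<noteq> {}" "p ` Y \<subseteq> Y" for Y
  proof -
    obtain s where s: "s \<in> Y" using Y by auto
    have "y \<in> Y" if "y \<in> orbit p s" for y
      using that by induction (use s Y in auto)
    moreover have "X = orbit p s" using cyc s Y by (auto simp: cyclic_on_alldef)
    ultimately show ?thesis using Y by auto
  qed
  with cyc show "X \<noteq> {} \<and> (\<forall>Y\<subseteq>X. Y \<noteq> {} \<longrightarrow> p ` Y \<subseteq> Y \<longrightarrow> Y = X)"
    by (auto simp: cyclic_on_def)
next
  assume *: "X \<noteq> {} \<and> (\<forall>Y\<subseteq>X. Y \<noteq> {} \<longrightarrow> p ` Y \<subseteq> Y \<longrightarrow> Y = X)"
  then obtain s where s: "s \<in> X" by auto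
  have "orbit p s = X"
    using * permutes_orbit_subset[OF assms s] orbit_nonempty[of p s]
    by (metis image_subsetI orbit.step)
  with s show "cyclic_on p X" by (auto simp: cyclic_on_def)
qed

lemma finite_cycles_on: "finite X \<Longrightarrow> finite (cycles_on X)"
  unfolding cycles_on_def by (rule finite_subset[OF _ finite_permutations]) auto

lemma cycles_on_singleton: "cycles_on {x} = {id}"
  by (auto simp: cycles_on_def permutes_sing cyclic_on_iff_closed)

lemma cycles_on_no_fixpoint:
  assumes "p \<in> cycles_on X" "x \<in> X" "X \<noteq> {x}"
  shows "p x \<noteq> x"
proof
  assume "p x = x"
  then have "X = {x}"
    using assms cyclic_on_iff_closed[of p X] unfolding cycles_on_def
    by (smt (verit, best) empty_iff image_empty image_insert insert_iff mem_Collect_eq subsetI)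
  with assms show False by simp
qed

text \<open>Composing on the right with the transposition turns the segment \<open>z\<close>,
  \<open>a\<close>, \<open>p a\<close> into \<open>z\<close>, \<open>p a\<close> and fixes
  \<open>a\<close>. Closed sets before and after the cut correspond by deleting or restoring
  \<open>a\<close>.\<close>

lemma remove_from_cycle_iff:
  assumes a: "a \<in> X" and z: "z \<in> X" "z \<noteq> a" "p z = a"
  shows "p \<in> cycles_on X \<longleftrightarrow> p \<circ> Transposition.transpose a z \<in> cycles_on (X - {a})"
proof -
  define q where "q = p \<circ> Transposition.transpose a z"
  have p: "p = q \<circ> Transposition.transpose a z" by (auto simp: q_def fun_eq_iff)
  have qa: "q a = a" and qz: "q z = p a" by (auto simp: q_def z)
  have qo: "q v = p v" if "v \<noteq> a" "v \<noteq> z" for v using that by (auto simp: q_def Transposition.transpose_def)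
  have perm: "p permutes X \<longleftrightarrow> q permutes (X - {a})"
  proof
    assume "p permutes X"
    then have "q permutes X" unfolding q_def using a z
      by (intro permutes_compose permutes_swap_id) auto
    then show "q permutes (X - {a})" by (rule permutes_superset) (use qa in auto)
  next
    assume "q permutes (X - {a})"
    then have "q permutes X" by (rule permutes_subset) auto
    then show "p permutes X" unfolding p using a z
      by (intro permutes_compose permutes_swap_id) auto
  qed
  have "cyclic_on p X \<longleftrightarrow> cyclic_on q (X - {a})" if pX: "p permutes X"
  proof -
    have qX: "q permutes (X - {a})" using pX perm by simp
    have pa: "p a \<noteq> a" using z permutes_inj[OF pX] by (metis injD)
    have "Y = X" if A: "\<forall>Y\<subseteq>X-{a}. Y \<noteq> {} \<longrightarrow> q ` Y \<subseteq> Y \<longrightarrow> Y = X-{a}"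
      and Y: "Y \<subseteq> X" "Y \<noteq> {}" "p ` Y \<subseteq> Y" for Y
    proof -
      have "q v \<in> Y - {a}" if v: "v \<in> Y - {a}" for v
      proof (cases "v = z")
        case True
        then have "a \<in> Y" using v Y z by auto
        then show ?thesis using True qz Y pa by auto
      next
        case False
        moreover have "p v \<noteq> a" using False z permutes_inj[OF pX] by (metis injD)
        ultimately show ?thesis using v Y qo by auto
      qed
      moreover have "Y - {a} \<noteq> {}" using Y pa by auto
      ultimately have "Y - {a} = X - {a}" using A Y by (metis Diff_mono image_subsetI order_refl)
      moreover from this have "z \<in> Y" using z by auto
      ultimately show ?thesis using Y z by auto
    qed
    moreover have "Y = X - {a}" if A: "\<forall>Y\<subseteq>X. Y \<noteq> {} \<longrightarrow> p ` Y \<subseteq> Y \<longrightarrow> Y = X"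
      and Y: "Y \<subseteq> X - {a}" "Y \<noteq> {}" "q ` Y \<subseteq> Y" for Y
    proof -
      \<comment> \<open>\<open>a\<close> must be added exactly when its predecessor \<open>z\<close>
        is present, for otherwise closedness under \<open>p\<close> fails at
        \<open>z\<close>.\<close>
      define Y' where "Y' = (if z \<in> Y then insert a Y else Y)"
      have "p v \<in> Y'" if v: "v \<in> Y'" for v
      proof -
        have q: "\<And>u. u \<in> Y \<Longrightarrow> q u \<in> Y" using Y by blast
        consider "v = a" "z \<in> Y" | "v = z" "z \<in> Y" | "v \<noteq> a" "v \<noteq> z" "v \<in> Y"
          using v Y(1) by (cases "z \<in> Y") (auto simp: Y'_def)
        then show ?thesis
          by cases (use q[of z] q[of v] qz qo[of v] z in \<open>auto simp: Y'_def\<close>)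
      qed
      moreover have "Y' \<subseteq> X" "Y' \<noteq> {}" using Y a by (auto simp: Y'_def)
      ultimately have "Y' = X" using A by blast
      then show ?thesis using Y a by (auto simp: Y'_def split: if_splits)
    qed
    moreover have "X \<noteq> {}" "X - {a} \<noteq> {}" using a z by auto
    ultimately show ?thesis
      unfolding cyclic_on_iff_closed[OF pX] cyclic_on_iff_closed[OF qX] by metis
  qed
  then show ?thesis using perm unfolding cycles_on_def q_def[symmetric] by auto
qed

text \<open>Conjugation moves a transposition from the left of \<open>q\<close> to the right;
  insertion below is written on the left, removal on the right.\<close>

lemma transpose_comp_inj:
  assumes "inj q"
  shows "Transposition.transpose (q a) (q b) \<circ> q = q \<circ> Transposition.transpose a b"
  by (rule ext) (simp add: Transposition.transpose_def inj_eq[OF assms])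

text \<open>Left multiplication by the transposition inserts \<open>x\<close> just before
  \<open>y\<close>: the predecessor of \<open>y\<close> now goes to \<open>x\<close>, and
  \<open>x\<close> to \<open>y\<close>. Hence \<open>y\<close> is recovered as \<open>p x\<close>,
  and the same transposition recovers \<open>q\<close>.\<close>

lemma bij_betw_insert_into_cycle:
  assumes x: "x \<in> X" "X \<noteq> {x}"
  shows "bij_betw (\<lambda>(y, q). Transposition.transpose x y \<circ> q) ((X - {x}) \<times> cycles_on (X - {x})) (cycles_on X)"
proof (rule bij_betw_byWitness[where f' = "\<lambda>p. (p x, Transposition.transpose x (p x) \<circ> p)"])
  have q_fix: "q x = x" if "q \<in> cycles_on (X - {x})" for q
    using that by (auto simp: cycles_on_def permutes_def)
  show "\<forall>u\<in>(X - {x}) \<times> cycles_on (X - {x}).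
      ((case u of (y, q) \<Rightarrow> Transposition.transpose x y \<circ> q) x,
       Transposition.transpose x ((case u of (y, q) \<Rightarrow> Transposition.transpose x y \<circ> q) x) \<circ> (case u of (y, q) \<Rightarrow> Transposition.transpose x y \<circ> q)) = u"
    by (auto simp: q_fix fun_eq_iff)
  show "\<forall>p\<in>cycles_on X. (case (p x, Transposition.transpose x (p x) \<circ> p) of (y, q) \<Rightarrow> Transposition.transpose x y \<circ> q) = p"
    by (auto simp: fun_eq_iff)
  show "(\<lambda>(y, q). Transposition.transpose x y \<circ> q) ` ((X - {x}) \<times> cycles_on (X - {x})) \<subseteq> cycles_on X"
  proof (rule image_subsetI)
    fix u assume "u \<in> (X - {x}) \<times> cycles_on (X - {x})"
    then obtain y q where u: "u = (y, q)" and y: "y \<in> X" "y \<noteq> x" and q: "q \<in> cycles_on (X - {x})"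
      by blast
    from q have qp: "q permutes (X - {x})" by (auto simp: cycles_on_def)
    obtain z where z: "q z = y" "z \<in> X" "z \<noteq> x"
    proof (rule that)
      show "q (inv q y) = y" using permutes_inverses(1)[OF qp] .
      have "inv q y \<in> X - {x}" using permutes_in_image[OF permutes_inv[OF qp], of y] y by simp
      then show "inv q y \<in> X" "inv q y \<noteq> x" by auto
    qed
    have "Transposition.transpose x y \<circ> q = q \<circ> Transposition.transpose x z"
      using transpose_comp_inj[OF permutes_inj[OF qp], of x z] by (simp add: z q_fix[OF q])
    moreover have "q \<circ> Transposition.transpose x z \<in> cycles_on X"
      using remove_from_cycle_iff[OF x(1) z(2,3), of "q \<circ> Transposition.transpose x z"] q
      by (simp add: comp_assoc q_fix[OF q])
    ultimately show "(case u of (y, q) \<Rightarrow> Transposition.transpose x y \<circ> q) \<in> cycles_on X"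
      by (simp add: u)
  qed
  show "(\<lambda>p. (p x, Transposition.transpose x (p x) \<circ> p)) ` cycles_on X \<subseteq> (X - {x}) \<times> cycles_on (X - {x})"
  proof (rule image_subsetI)
    fix p assume p: "p \<in> cycles_on X"
    then have pp: "p permutes X" by (auto simp: cycles_on_def)
    have px: "p x \<noteq> x" using cycles_on_no_fixpoint[OF p x] .
    obtain z where z: "p z = x" "z \<in> X" "z \<noteq> x"
    proof (rule that)
      show p_inv: "p (inv p x) = x" using permutes_inverses(1)[OF pp] .
      show "inv p x \<in> X" using permutes_in_image[OF permutes_inv[OF pp], of x] x by simp
      show "inv p x \<noteq> x" using p_inv px by auto
    qed
    have "Transposition.transpose x (p x) \<circ> p = p \<circ> Transposition.transpose x z"
      using transpose_comp_inj[OF permutes_inj[OF pp], of z x]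
      by (simp add: z Transposition.transpose_commute)
    moreover have "p \<circ> Transposition.transpose x z \<in> cycles_on (X - {x})"
      using remove_from_cycle_iff[OF x(1) z(2,3), of p] z(1) p by simp
    ultimately show "(p x, Transposition.transpose x (p x) \<circ> p) \<in> (X - {x}) \<times> cycles_on (X - {x})"
      using px permutes_in_image[OF pp] x by simp
  qed
qed

lemma card_cycles_on:
  assumes "finite X" "X \<noteq> {}"
  shows "card (cycles_on X) = fact (card X - 1)"
  using assms
proof (induction "card X" arbitrary: X)
  case (Suc n)
  then obtain x where x: "x \<in> X" by auto
  show ?case
  proof (cases "X = {x}")
    case True
    then show ?thesis by (simp add: cycles_on_singleton)
  next
    case False
    then have ne: "X - {x} \<noteq> {}" using x by auto
    have "card (cycles_on X) = card ((X - {x}) \<times> cycles_on (X - {x}))"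
      using bij_betw_same_card[OF bij_betw_insert_into_cycle[OF x False]] by simp
    also have "\<dots> = n * fact (n - 1)"
    proof -
      have c: "card (X - {x}) = n" using Suc(2,3) x by simp
      show ?thesis using Suc(1)[OF c[symmetric]] Suc(3) ne by (simp add: card_cartesian_product c)
    qed
    also have "\<dots> = fact n"
      using ne Suc x fact_reduce[of n, where 'a=nat]
      by (metis card_Diff_singleton card_gt_0_iff diff_Suc_1 finite_Diff of_nat_id)
    finally show ?thesis using Suc by (metis diff_Suc_1)
  qed
qed auto

text \<open>For a map \<open>h\<close> on colours, where all colours outside \<open>R\<close> are roots, the absence of a closed
  subset of \<open>R\<close> means that the arcs \<open>i \<rightarrow> h i\<close> (\<open>i \<in> R\<close>) form a forest directed towards the roots.\<close>

definition tree :: "'k set \<Rightarrow> ('k \<Rightarrow> 'k) \<Rightarrow> bool" where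
  "tree R h \<longleftrightarrow> (\<forall>C\<subseteq>R. C \<noteq> {} \<longrightarrow> \<not> h ` C \<subseteq> C)"

lemma tree_cong: "(\<And>i. i \<in> R \<Longrightarrow> h i = h' i) \<Longrightarrow> tree R h \<longleftrightarrow> tree R h'"
  unfolding tree_def by (metis image_cong subsetD)

text \<open>Contracting the arc leaving \<open>i\<close> redirects every arc that enters
  \<open>i\<close> to \<open>h i\<close>. A loop at \<open>i\<close> is itself a closed set; any
  other closed set survives after deleting \<open>i\<close>, and is lifted back by restoring
  \<open>i\<close> if one of its arcs enters \<open>i\<close>.\<close>

lemma tree_contract:
  assumes "i \<in> R"
  shows "tree R h \<longleftrightarrow> h i \<noteq> i \<and> tree (R - {i}) (\<lambda>m. if h m = i then h i else h m)"
    (is "_ \<longleftrightarrow> _ \<and> tree _ ?h'")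
proof (intro iffI conjI)
  assume T: "tree R h"
  show ne: "h i \<noteq> i"
  proof
    assume "h i = i"
    moreover have "\<not> h ` {i} \<subseteq> {i}" using T assms unfolding tree_def by blast
    ultimately show False by simp
  qed
  show "tree (R - {i}) ?h'" unfolding tree_def
  proof (intro allI impI notI)
    fix C assume C: "C \<subseteq> R - {i}" "C \<noteq> {}" "?h' ` C \<subseteq> C"
    define C' where "C' = (if i \<in> h ` C then insert i C else C)"
    have sub: "\<And>m. m \<in> C \<Longrightarrow> ?h' m \<in> C" using C by blast
    have "h m \<in> C'" if "m \<in> C'" for m
    proof (cases "m = i")
      case True
        then have "i \<in> h ` C" using that C(1) by (metis C'_def DiffE insertI1 subsetD)
      then obtain k where "k \<in> C" "h k = i" by blast
      then show ?thesis using sub[of k] True by (auto simp: C'_def)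
    next
      case False
      then have "m \<in> C" using that by (auto simp: C'_def split: if_splits)
      then show ?thesis using sub[of m] by (auto simp: C'_def split: if_splits)
    qed
    moreover have "C' \<subseteq> R" "C' \<noteq> {}" using C assms by (auto simp: C'_def)
    ultimately show False using T unfolding tree_def by blast
  qed
next
  assume A: "h i \<noteq> i \<and> tree (R - {i}) ?h'"
  show "tree R h" unfolding tree_def
  proof (intro allI impI notI)
    fix C assume C: "C \<subseteq> R" "C \<noteq> {}" "h ` C \<subseteq> C"
    have "?h' ` (C - {i}) \<subseteq> C - {i}"
    proof
      fix v assume "v \<in> ?h' ` (C - {i})"
      then obtain m where m: "m \<in> C" "v = ?h' m" by (elim imageE DiffE) blast
      have "h m \<in> C" using m C by auto
      then show "v \<in> C - {i}" using m A C by (auto split: if_splits)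
    qed
    moreover have "C - {i} \<noteq> {}" using C A by auto
    moreover have "C - {i} \<subseteq> R - {i}" using C by auto
    ultimately show False using A unfolding tree_def by blast
  qed
qed

text \<open>No arc enters \<open>i\<close>, not even its own, so there is no loop and contraction at
  \<open>i\<close> redirects nothing.\<close>

lemma tree_remove_leaf:
  assumes "\<And>m. m \<in> R \<Longrightarrow> h m \<noteq> i"
  shows "tree R h \<longleftrightarrow> tree (R - {i}) h"
proof (cases "i \<in> R")
  case True
  have "tree (R - {i}) (\<lambda>m. if h m = i then h i else h m) \<longleftrightarrow> tree (R - {i}) h"
    by (rule tree_cong) (use assms in auto)
  then show ?thesis using tree_contract[OF True, of h] assms True by simp
qed simp

lemma card_filter_bij:
  assumes "bij_betw f A B"
  shows "card {b \<in> B. P b} = card {a \<in> A. P (f a)}"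
proof -
  have "bij_betw f {a \<in> A. P (f a)} {b \<in> B. P b}"
    using assms by (auto simp: bij_betw_def inj_on_def)
  then show ?thesis using bij_betw_same_card by metis
qed

section \<open>Full cycles for which fixed arcs form a tree\<close>

text \<open>The successor of \<open>x = s i\<close> is \<open>y\<close>, so the arc of
  \<open>i\<close> ends at \<open>c y\<close>, and contracting it merges colour \<open>i\<close>
  into \<open>c y\<close>; this is the recolouring \<open>c'\<close>. The only other arc that can
  change is the one into \<open>y\<close>: it now ends at \<open>x\<close>, in colour
  \<open>i\<close>, and contraction sends it back to \<open>c y\<close>.\<close>

lemma tree_insert_into_cycle:
  assumes "i \<notin> R" "x \<in> X" "q \<in> cycles_on (X - {x})" "s i = x" "y \<noteq> x"
    and s: "\<And>m. m \<in> insert i R \<Longrightarrow> s m \<in> X \<and> c (s m) = m"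
  defines "c' \<equiv> \<lambda>v. if c v = i then c y else c v"
  shows "tree (insert i R) (\<lambda>m. c ((Transposition.transpose x y \<circ> q) (s m)))
    \<longleftrightarrow> c y \<noteq> i \<and> tree R (\<lambda>m. c' (q (s m)))"
proof -
  have qp: "q permutes (X - {x})" using assms by (auto simp: cycles_on_def)
  have qx: "q x = x" using qp by (auto simp: permutes_def)
  have cx: "c x = i" using s[of i] assms(4) by auto
  define h where "h = (\<lambda>m. c ((Transposition.transpose x y \<circ> q) (s m)))"
  have hi: "h i = c y" by (simp add: h_def assms(4) qx)
  have "tree R (\<lambda>m. if h m = i then h i else h m) \<longleftrightarrow> tree R (\<lambda>m. c' (q (s m)))" if y: "c y \<noteq> i"
  proof (rule tree_cong)
    fix m assume m: "m \<in> R"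
    then have "s m \<in> X - {x}" using s[of m] s[of i] cx assms by auto
    then have ne: "q (s m) \<noteq> x" using permutes_in_image[OF qp, of "s m"] by auto
    have "h m = (if q (s m) = y then i else c (q (s m)))"
      using ne cx by (auto simp: h_def Transposition.transpose_def)
    then show "(if h m = i then h i else h m) = c' (q (s m))"
      using y by (auto simp: hi c'_def)
  qed
  moreover have "insert i R - {i} = R" using assms by auto
  ultimately show ?thesis
    using tree_contract[of i "insert i R" h] unfolding h_def[symmetric] hi by auto
qed

text \<open>In a random full cycle the chosen arcs form a tree with probability (number of points of
  root colour) / (|X| - |R|). Each induction step contracts the arc of one colour \<open>i\<close>,
  averaging over the successor of \<open>s i\<close>. The product form also covers |X| = |R|, where
  no point has a root colour.\<close>

lemma card_tree_cycles:
  assumes "finite R" "finite X" "X \<noteq> {}" "\<And>i. i \<in> R \<Longrightarrow> s i \<in> X \<and> c (s i) = i"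
  shows "card {p \<in> cycles_on X. tree R (\<lambda>i. c (p (s i)))} * (card X - card R)
    = fact (card X - 1) * card {x \<in> X. c x \<notin> R}"
  using assms
proof (induction R arbitrary: X c rule: finite_induct)
  case empty
  then show ?case using card_gt_0_iff[of X] by (simp add: tree_def card_cycles_on)
next
  case (insert i R)
  define x where "x = s i"
  have x: "x \<in> X" "c x = i" using insert.prems by (auto simp: x_def)
  show ?case
  proof (cases "X = {x}")
    case True
    have "\<not> tree (insert i R) (\<lambda>m. c (id (s m)))"
      using tree_contract[of i "insert i R" "\<lambda>m. c (id (s m))"] x by (auto simp: x_def)
    then show ?thesis using x by (simp add: True cycles_on_singleton Collect_conv_if)
  next
    case False
    have fin: "finite X" by fact
    then have N: "card (X - {x}) = card X - 1" "card X - 1 \<ge> 1"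
      using False x card_gt_0_iff[of "X - {x}"] by auto
    define T where "T = (\<lambda>y. {q \<in> cycles_on (X - {x}).
        tree (insert i R) (\<lambda>m. c ((Transposition.transpose x y \<circ> q) (s m)))})"
    \<comment> \<open>The count splits by the colour of the successor \<open>y\<close>: in
      \<open>A\<close> the arc is a loop, in \<open>W\<close> it joins the class of \<open>i\<close>
      to the roots, and in \<open>B\<close> the number of root points stays |W|.\<close>
    define A where "A = {v \<in> X. c v = i}"
    define W where "W = {v \<in> X. c v \<notin> insert i R}"
    define B where "B = {v \<in> X. c v \<in> R}"
    have fins: "finite A" "finite W" "finite B" using fin by (auto simp: A_def W_def B_def)
    have part: "X = A \<union> (W \<union> B)" by (auto simp: A_def W_def B_def)
    have NX: "card X = card A + (card W + card B)"
      unfolding part by (subst card_Un_disjoint; (subst card_Un_disjoint)?)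
        (use fins insert.hyps in \<open>auto simp: A_def W_def B_def\<close>)
    have A1: "card A \<ge> 1" using x fins card_gt_0_iff[of A] by (auto simp: A_def Suc_le_eq)
    have eq: "{p \<in> (X - {x}) \<times> cycles_on (X - {x}). tree (insert i R)
        (\<lambda>m. c ((case p of (y, q) \<Rightarrow> Transposition.transpose x y \<circ> q) (s m)))} = Sigma (X - {x}) T"
      by (auto simp: T_def)
    have "card {p \<in> cycles_on X. tree (insert i R) (\<lambda>i. c (p (s i)))} = card (Sigma (X - {x}) T)"
      using card_filter_bij[OF bij_betw_insert_into_cycle[OF x(1) False],
          of "\<lambda>p. tree (insert i R) (\<lambda>i. c (p (s i)))"] unfolding eq .
    also have "\<dots> = (\<Sum>y\<in>X - {x}. card (T y))"
      by (rule card_SigmaI) (auto simp: T_def fin finite_cycles_on)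
    finally have count: "card {p \<in> cycles_on X. tree (insert i R) (\<lambda>i. c (p (s i)))}
        = (\<Sum>y\<in>X - {x}. card (T y))" .
    have T: "card (T y) * (card X - card (insert i R)) =
        (if y \<in> W then fact (card X - 2) * (card A - 1 + card W)
         else if y \<in> B then fact (card X - 2) * card W else 0)" if y: "y \<in> X - {x}" for y
    proof -
      have T_iff: "tree (insert i R) (\<lambda>m. c ((Transposition.transpose x y \<circ> q) (s m)))
          \<longleftrightarrow> c y \<noteq> i \<and> tree R (\<lambda>m. (if c (q (s m)) = i then c y else c (q (s m))))"
        if "q \<in> cycles_on (X - {x})" for q
        by (rule tree_insert_into_cycle[of i R x X]) (use insert.hyps insert.prems x y that in \<open>auto simp: x_def\<close>)
      show ?thesis
      proof (cases "c y = i")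
        case True
        then have "T y = {}" using T_iff by (auto simp: T_def)
        then show ?thesis using True insert.hyps by (auto simp: W_def B_def)
      next
        case False
        define c' where "c' = (\<lambda>v. if c v = i then c y else c v)"
        have "T y = {q \<in> cycles_on (X - {x}). tree R (\<lambda>m. c' (q (s m)))}"
          using T_iff False by (auto simp: T_def c'_def)
        moreover have "card {q \<in> cycles_on (X - {x}). tree R (\<lambda>m. c' (q (s m)))} *
            (card (X - {x}) - card R) = fact (card (X - {x}) - 1) * card {v \<in> X - {x}. c' v \<notin> R}"
          by (rule insert.IH) (use insert.prems insert.hyps x y in \<open>auto simp: c'_def\<close>)
        moreover have "card X - card (insert i R) = card (X - {x}) - card R"
          using insert.hyps N by simp
        ultimately have *: "card (T y) * (card X - card (insert i R)) =
            fact (card X - 2) * card {v \<in> X - {x}. c' v \<notin> R}"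
          using N by (simp add: numeral_2_eq_2)
        show ?thesis
        proof (cases "c y \<in> R")
          case True
          then have "{v \<in> X - {x}. c' v \<notin> R} = W" using x by (auto simp: c'_def W_def)
          then show ?thesis using * True y by (auto simp: B_def W_def)
        next
          case F: False
          then have "{v \<in> X - {x}. c' v \<notin> R} = (A - {x}) \<union> W"
            using x by (auto simp: c'_def W_def A_def)
          moreover have "card ((A - {x}) \<union> W) = card A - 1 + card W"
            by (subst card_Un_disjoint) (use fins x in \<open>auto simp: A_def W_def\<close>)
          ultimately show ?thesis using * F False y by (auto simp: B_def W_def)
        qed
      qed
    qed
    have "(\<Sum>y\<in>X - {x}. card (T y)) * (card X - card (insert i R)) =
       (\<Sum>y\<in>X - {x}. if y \<in> W then fact (card X - 2) * (card A - 1 + card W)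
         else if y \<in> B then fact (card X - 2) * card W else 0)"
      by (simp add: sum_distrib_right T)
    also have "\<dots> = (\<Sum>y\<in>W \<union> B. if y \<in> W then fact (card X - 2) * (card A - 1 + card W)
         else if y \<in> B then fact (card X - 2) * card W else 0)"
      by (rule sum.mono_neutral_right) (use fin x insert.hyps in \<open>auto simp: W_def B_def\<close>)
    also have "\<dots> = (\<Sum>y\<in>W. fact (card X - 2) * (card A - 1 + card W)) + (\<Sum>y\<in>B. fact (card X - 2) * card W)"
      by (subst sum.union_disjoint) (use fins in \<open>auto simp: W_def B_def intro!: arg_cong2[where f="(+)"] sum.cong\<close>)
    \<comment> \<open>Here |W| (|A| - 1 + |W|) + |B| |W| = |W| (|X| - 1), because the three classes
      partition \<open>X\<close>.\<close>
    also have "\<dots> = fact (card X - 2) * (card X - 1) * card W"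
    proof -
      have "card X - 1 = card A - 1 + card W + card B" using NX A1 by simp
      then show ?thesis by (simp add: algebra_simps)
    qed
    also have "fact (card X - 2) * (card X - 1) = (fact (card X - 1) :: nat)"
      using N fact_reduce[of "card X - 1", where 'a=nat] by (simp add: numeral_2_eq_2 mult.commute)
    finally show ?thesis unfolding count W_def .
  qed
qed

section \<open>Pairs of full cycles with colour-preserving product\<close>

text \<open>Cutting out \<open>a\<close> behind \<open>z\<close> makes \<open>z\<close> inherit the
  successor of \<open>a\<close>, and with it the prescribed colour \<open>g a\<close>.\<close>

lemma card_cycles_step:
  assumes a: "a \<in> X" and z: "z \<in> X" "z \<noteq> a" and ca: "c a = g z"
  shows "card {p \<in> cycles_on X. p z = a \<and> (\<forall>x\<in>X. c (p x) = g x)}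
    = card {q \<in> cycles_on (X - {a}). \<forall>x\<in>X - {a}. c (q x) = (g(z := g a)) x}"
    (is "card ?P = card ?Q")
proof (rule bij_betw_same_card)
  let ?f = "\<lambda>p. p \<circ> Transposition.transpose a z"
  have q_fix: "q a = a" if "q \<in> cycles_on (X - {a})" for q
    using that by (auto simp: cycles_on_def permutes_def)
  have "?f p \<in> ?Q" if p: "p \<in> ?P" for p
  proof -
    have "?f p \<in> cycles_on (X - {a})"
      using p remove_from_cycle_iff[of a X z p] a z by simp
    moreover have "c (?f p x) = (g(z := g a)) x" if "x \<in> X - {a}" for x
      using that p a by (cases "x = z") (auto simp: Transposition.transpose_def)
    ultimately show ?thesis by blast
  qed
  moreover have "?f q \<in> ?P" if q: "q \<in> ?Q" for q
  proof -
    have fz: "?f q z = a" using q_fix[of q] q by auto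
    have "?f q \<in> cycles_on X"
      using q remove_from_cycle_iff[of a X z "?f q"] a z fz by (simp add: comp_assoc)
    moreover have "c (?f q x) = g x" if x: "x \<in> X" for x
    proof -
      consider "x = a" | "x = z" | "x \<noteq> a" "x \<noteq> z" by blast
      then show ?thesis
      proof cases
        case 1
        have "c (q z) = (g(z := g a)) z" using q z by blast
        then show ?thesis using 1 by simp
      next
        case 2
        then show ?thesis using fz ca by simp
      next
        case 3
        then have "c (q x) = (g(z := g a)) x" using q x by blast
        then show ?thesis using 3 by (simp add: Transposition.transpose_def)
      qed
    qed
    ultimately show ?thesis using fz by blast
  qed
  moreover have ff: "?f (?f p) = p" for p :: "'a \<Rightarrow> 'a" by (auto simp: fun_eq_iff)
  ultimately show "bij_betw ?f ?P ?Q"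
    by (intro bij_betw_byWitness[where f' = ?f] ballI image_subsetI) (simp_all only: ff)
qed

text \<open>As a multiset, the prescribed colours lose exactly one copy of \<open>g z\<close>, since
  \<open>g a\<close> merely moves from \<open>a\<close> to \<open>z\<close>. The subtraction is not
  truncated, as \<open>z\<close> lies in the fibre of \<open>g z\<close>.\<close>

lemma card_fibre_step:
  assumes a: "a \<in> X" and z: "z \<in> X" "z \<noteq> a" and X: "finite X"
  shows "card {x \<in> X - {a}. (g(z := g a)) x = j} = card {x \<in> X. g x = j} - (if j = g z then 1 else 0)"
proof -
  let ?S = "{x \<in> X. g x = j}"
  have fin: "finite ?S" using X by auto
  consider "j = g z" "g a = j" | "j = g z" "g a \<noteq> j" | "j \<noteq> g z" "g a = j" | "j \<noteq> g z" "g a \<noteq> j"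
    by blast
  then show ?thesis
  proof cases
    case 1
    then have "{x \<in> X - {a}. (g(z := g a)) x = j} = ?S - {a}" using a z by auto
    then show ?thesis using 1 a fin by simp
  next
    case 2
    then have "{x \<in> X - {a}. (g(z := g a)) x = j} = ?S - {z}" using a z by auto
    then show ?thesis using 2 z fin by simp
  next
    case 3
    then have "{x \<in> X - {a}. (g(z := g a)) x = j} = insert z (?S - {a})" using a z by auto
    moreover have "card (insert z (?S - {a})) = Suc (card (?S - {a}))"
      using 3 fin by (subst card_insert_disjoint) auto
    moreover have "Suc (card (?S - {a})) = card ?S"
      using 3 a fin by (intro card_Suc_Diff1) auto
    ultimately show ?thesis using 3 by simp
  next
    case 4
    then have "{x \<in> X - {a}. (g(z := g a)) x = j} = ?S" using a z by auto
    then show ?thesis using 4 by simp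
  qed
qed

lemma card_1_eq: "card A = 1 \<Longrightarrow> z \<in> A \<Longrightarrow> A = {z}"
  by (auto simp: card_1_singleton_iff)

abbreviation col_class :: "('a \<Rightarrow> 'k) \<Rightarrow> 'a set \<Rightarrow> 'k \<Rightarrow> 'a set" where
  "col_class c X i \<equiv> {x \<in> X. c x = i}"

text \<open>A form of the BEST theorem. The induction follows the tour from an element \<open>z\<close> of root colour:
  its successor \<open>a\<close> is chosen in the class \<open>g z\<close> and then removed from the cycle. The arc leaving \<open>z\<close>
  is never used by a tree, so redirecting it does not change the set of trees, and removing \<open>a\<close>
  only excludes those trees which use the arc of \<open>a\<close>.\<close>

lemma card_cycles_colour_successors:
  fixes c g :: "'a \<Rightarrow> 'k"
  assumes "finite X" "finite R" "w \<notin> R" "c ` X \<subseteq> insert w R" "g ` X \<subseteq> insert w R"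
    and "\<And>i. i \<in> insert w R \<Longrightarrow> card (col_class g X i) = card (col_class c X i)"
    and "\<And>i. i \<in> insert w R \<Longrightarrow> col_class c X i \<noteq> {}"
  shows "card {p \<in> cycles_on X. \<forall>x\<in>X. c (p x) = g x}
    = (\<Prod>i\<in>insert w R. fact (card (col_class c X i) - 1))
      * card {s \<in> Pi\<^sub>E R (col_class c X). tree R (\<lambda>i. g (s i))}"
  using assms
proof (induction "card X" arbitrary: X R g rule: less_induct)
  case less
  note fX = less.prems(1) and fR = less.prems(2) and wR = less.prems(3) and cX = less.prems(4)
    and gX = less.prems(5) and fib = less.prems(6) and ne = less.prems(7)
  obtain z where z: "z \<in> X" "c z = w" using ne[of w] by auto
  define i where "i = g z"
  define E where "E = (\<Prod>j\<in>R. fact (card (col_class c X j) - 1) :: nat)"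
  define T where "T = {s \<in> Pi\<^sub>E R (col_class c X). tree R (\<lambda>i. g (s i))}"
  have fin_class: "finite (col_class c X j)" for j using fX by simp
  have finT: "finite T" unfolding T_def
    by (rule finite_subset[OF _ finite_PiE[OF fR, of "col_class c X"]]) (use fin_class in auto)
  have goal: ?case if "card {p \<in> cycles_on X. \<forall>x\<in>X. c (p x) = g x}
      = fact (card (col_class c X w) - 1) * E * card T"
    using that fR wR by (simp add: E_def T_def)
  have iR: "i \<in> insert w R" using gX z by (auto simp: i_def)
  show ?case
  proof (cases "X = {z}")
    case True
    have "R = {}"
    proof (rule ccontr)
      assume "R \<noteq> {}"
      then obtain j where "j \<in> R" by auto
      then show False using ne[of j] True z wR by auto
    qed
    then show ?thesis using True z gX
      by (simp add: cycles_on_singleton tree_def Collect_conv_if)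
  next
    case False
    define F where "F = (\<lambda>a. {p \<in> cycles_on X. p z = a \<and> (\<forall>x\<in>X. c (p x) = g x)})"
    have finF: "finite (F a)" for a using finite_cycles_on[OF fX] by (auto simp: F_def)
    \<comment> \<open>The cycles are sorted by the successor \<open>a\<close> of \<open>z\<close>:
      it has colour \<open>i = g z\<close>, and \<open>a = z\<close> is excluded because
      \<open>X\<close> has another point.\<close>
    have "{p \<in> cycles_on X. \<forall>x\<in>X. c (p x) = g x} = (\<Union>a\<in>col_class c X i - {z}. F a)"
      using cycles_on_no_fixpoint[OF _ z(1) False] z
      by (auto simp: F_def i_def cycles_on_def permutes_in_image)
    moreover have "card (\<Union>a\<in>col_class c X i - {z}. F a) = (\<Sum>a\<in>col_class c X i - {z}. card (F a))"
      by (rule card_UN_disjoint) (use fin_class finF in \<open>auto simp: F_def\<close>)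
    ultimately have count: "card {p \<in> cycles_on X. \<forall>x\<in>X. c (p x) = g x}
        = (\<Sum>a\<in>col_class c X i - {z}. card (F a))" by simp
    have F: "card (F a) = card {q \<in> cycles_on (X - {a}). \<forall>x\<in>X - {a}. c (q x) = (g(z := g a)) x}"
      if "a \<in> col_class c X i - {z}" for a
      unfolding F_def using that z by (intro card_cycles_step) (auto simp: i_def)
    have fib': "card (col_class (g(z := g a)) (X - {a}) j) = card (col_class c (X - {a}) j)"
      if a: "a \<in> col_class c X i - {z}" and j: "j \<in> insert w R" for a j
    proof -
      have "col_class c (X - {a}) j = col_class c X j - {a}" by auto
      then have "card (col_class c (X - {a}) j) = card (col_class c X j) - (if j = i then 1 else 0)"
        using a fX by (simp add: card_Diff_singleton_if)
      moreover have "card (col_class (g(z := g a)) (X - {a}) j) = card (col_class g X j) - (if j = g z then 1 else 0)"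
        by (rule card_fibre_step) (use a z fX in auto)
      ultimately show ?thesis by (simp only: i_def fib[OF j])
    qed
    have smaller: "card (X - {a}) < card X" if "a \<in> col_class c X i - {z}" for a
      using that fX by (intro card_Diff1_less) auto
    have g'X: "(g(z := g a)) ` (X - {a}) \<subseteq> insert w R" if "a \<in> col_class c X i - {z}" for a
      using that gX by auto
    have class': "col_class c (X - {a}) j = col_class c X j" if "a \<in> col_class c X i" "j \<noteq> i" for a j
      using that by auto
    have sz: "s j \<noteq> z" if "s \<in> Pi\<^sub>E R (col_class c X)" "j \<in> R" for s j
      using that z wR by (auto simp: PiE_iff)
    show ?thesis
    proof (cases "i = w")
      case iw: True
      \<comment> \<open>If the successor of \<open>z\<close> has the root colour, every
        \<open>a\<close> leaves the same trees and only shrinks the root class.\<close>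
      have "card (F a) = fact (card (col_class c X w) - 2) * E * card T"
        if a: "a \<in> col_class c X i - {z}" for a
      proof -
        have PiE': "Pi\<^sub>E R (col_class c (X - {a})) = Pi\<^sub>E R (col_class c X)"
          by (rule PiE_cong) (use a iw wR class' in auto)
        have "card (F a) = (\<Prod>j\<in>insert w R. fact (card (col_class c (X - {a}) j) - 1)) *
           card {s \<in> Pi\<^sub>E R (col_class c (X - {a})). tree R (\<lambda>j. (g(z := g a)) (s j))}"
          unfolding F[OF a]
        proof (rule less.hyps[OF smaller[OF a]])
          show "col_class c (X - {a}) j \<noteq> {}" if "j \<in> insert w R" for j
            using that class'[of a j] ne[of j] a z iw by (cases "j = w") auto
        qed (use fX fR wR cX g'X[OF a] fib'[OF a] in auto)
        also have "{s \<in> Pi\<^sub>E R (col_class c (X - {a})). tree R (\<lambda>j. (g(z := g a)) (s j))} = T"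
          unfolding PiE' T_def
          by (intro Collect_cong conj_cong refl tree_cong) (use sz in simp)
        also have "(\<Prod>j\<in>insert w R. fact (card (col_class c (X - {a}) j) - 1))
            = fact (card (col_class c X w) - 2) * E"
        proof -
          have "col_class c (X - {a}) w = col_class c X w - {a}" by auto
          then have "card (col_class c (X - {a}) w) - 1 = card (col_class c X w) - 2"
            using a iw fX by (simp add: numeral_2_eq_2)
          moreover have "(\<Prod>j\<in>R. fact (card (col_class c (X - {a}) j) - 1)) = E"
            unfolding E_def by (rule prod.cong[OF refl], subst class') (use a wR iw in auto)
          ultimately show ?thesis using fR wR by simp
        qed
        finally show ?thesis .
      qed
      then have sum: "card {p \<in> cycles_on X. \<forall>x\<in>X. c (p x) = g x}
          = (card (col_class c X w) - 1) * (fact (card (col_class c X w) - 2) * E * card T)"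
        unfolding count using z iw by simp
      show ?thesis
      proof (cases "card (col_class c X w) \<ge> 2")
        case True
        then have "fact (card (col_class c X w) - 1) =
            (card (col_class c X w) - 1) * (fact (card (col_class c X w) - 2) :: nat)"
          using fact_reduce[of "card (col_class c X w) - 1", where 'a=nat] by (simp add: numeral_2_eq_2)
        then show ?thesis by (intro goal) (simp add: sum)
      next
        case False
        \<comment> \<open>Now \<open>z\<close> is the whole root class and the only point with
          \<open>g\<close>-value \<open>w\<close>. Tree arcs never start at \<open>z\<close>, so all
          of them stay in \<open>R\<close> and there is no tree; nor is there any choice of
          \<open>a\<close>.\<close>
        then have "card (col_class c X w) = 1"
          using z fin_class[of w] card_gt_0_iff[of "col_class c X w"] by auto
        then have gz: "col_class c X w = {z}" "col_class g X w = {z}"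
          using z fib[of w] iw by (intro card_1_eq; simp add: i_def)+
        have "\<not> tree R (\<lambda>j. g (s j))" if s: "s \<in> Pi\<^sub>E R (col_class c X)" for s
        proof -
          have "R \<noteq> {}" using gz False \<open>X \<noteq> {z}\<close> cX z by auto
          moreover have "g (s j) \<in> R" if j: "j \<in> R" for j
          proof -
            have "s j \<in> X" using s j by (auto simp: PiE_iff)
            then show ?thesis using sz[OF s j] gz gX by auto
          qed
          ultimately show ?thesis unfolding tree_def by blast
        qed
        then have "T = {}" by (auto simp: T_def)
        then show ?thesis by (intro goal) (simp add: sum)
      qed
    next
      case iw: False
      then have iR: "i \<in> R" using iR by simp
      have zi: "z \<notin> col_class c X i" using z iw by simp
      then have Diff_z: "col_class c X i - {z} = col_class c X i" by simp
      define E' where "E' = (\<Prod>j\<in>R - {i}. fact (card (col_class c X j) - 1) :: nat)"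
      have E: "E = fact (card (col_class c X i) - 1) * E'"
        unfolding E_def E'_def using fR iR by (simp add: prod.remove)
      have E'_class: "(\<Prod>j\<in>R - {i}. fact (card (col_class c (X - {a}) j) - 1)) = E'"
        if "a \<in> col_class c X i" for a
        unfolding E'_def by (rule prod.cong[OF refl], subst class'[OF that]) auto
      show ?thesis
      proof (cases "card (col_class c X i) \<ge> 2")
        case True
        \<comment> \<open>Colour \<open>i\<close> keeps a point after the removal of
          \<open>a\<close>, so the remaining trees are those whose arc at \<open>i\<close> does not
          start at \<open>a\<close>.\<close>
        have "card (F a) = fact (card (col_class c X w) - 1) * (fact (card (col_class c X i) - 2) * E')
            * card {s \<in> T. s i \<noteq> a}" if a: "a \<in> col_class c X i" for a
        proof -
          have az: "a \<in> col_class c X i - {z}" using a Diff_z by blast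
          have class_i: "col_class c (X - {a}) i = col_class c X i - {a}" by auto
          then have card_i: "card (col_class c (X - {a}) i) = card (col_class c X i) - 1"
            using a fX by simp
          have "card (F a) = (\<Prod>j\<in>insert w R. fact (card (col_class c (X - {a}) j) - 1)) *
             card {s \<in> Pi\<^sub>E R (col_class c (X - {a})). tree R (\<lambda>j. (g(z := g a)) (s j))}"
            unfolding F[OF az]
          proof (rule less.hyps[OF smaller[OF az]])
            show "col_class c (X - {a}) j \<noteq> {}" if "j \<in> insert w R" for j
            proof (cases "j = i")
              assume ji: "j = i"
              have "card (col_class c (X - {a}) j) \<noteq> 0" using card_i True ji by simp
              then show ?thesis by (metis card.empty)
            qed (use that class'[OF a] ne in simp)
          qed (use fX fR wR cX g'X[OF az] fib'[OF az] in auto)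
          also have "{s \<in> Pi\<^sub>E R (col_class c (X - {a})). tree R (\<lambda>j. (g(z := g a)) (s j))}
              = {s \<in> T. s i \<noteq> a}"
          proof -
            have 1: "s \<in> Pi\<^sub>E R (col_class c (X - {a})) \<longleftrightarrow> s \<in> Pi\<^sub>E R (col_class c X) \<and> s i \<noteq> a" for s
              using a iR by (auto simp: PiE_iff)
            have 2: "tree R (\<lambda>j. (g(z := g a)) (s j)) \<longleftrightarrow> tree R (\<lambda>j. g (s j))"
              if "s \<in> Pi\<^sub>E R (col_class c X)" for s
              by (rule tree_cong) (use sz[OF that] in simp)
            show ?thesis
            proof (rule set_eqI)
              fix s
              show "s \<in> {s \<in> Pi\<^sub>E R (col_class c (X - {a})). tree R (\<lambda>j. (g(z := g a)) (s j))}
                  \<longleftrightarrow> s \<in> {s \<in> T. s i \<noteq> a}"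
                using 1[of s] 2[of s] by (simp only: T_def mem_Collect_eq) argo
            qed
          qed
          also have "(\<Prod>j\<in>insert w R. fact (card (col_class c (X - {a}) j) - 1))
              = fact (card (col_class c X w) - 1) * (fact (card (col_class c X i) - 2) * E')"
            using fR wR iR card_i class'[OF a, of w] iw E'_class[OF a]
            by (simp add: prod.remove[of R i] numeral_2_eq_2)
          finally show ?thesis .
        qed
        then have "card {p \<in> cycles_on X. \<forall>x\<in>X. c (p x) = g x}
            = fact (card (col_class c X w) - 1) * (fact (card (col_class c X i) - 2) * E')
              * (\<Sum>a\<in>col_class c X i. card {s \<in> T. s i \<noteq> a})"
          unfolding count Diff_z by (simp add: sum_distrib_left)
        \<comment> \<open>Double counting: a selection \<open>s\<close> survives for every
          \<open>a\<close> except \<open>s i\<close>.\<close>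
        also have "(\<Sum>a\<in>col_class c X i. card {s \<in> T. s i \<noteq> a}) = (card (col_class c X i) - 1) * card T"
        proof (rule sum_multicount[OF fin_class finT], intro ballI)
          fix s assume "s \<in> T"
          then have "s i \<in> col_class c X i" using iR unfolding T_def PiE_iff by blast
          moreover have "{a \<in> col_class c X i. s i \<noteq> a} = col_class c X i - {s i}" by auto
          ultimately show "card {a \<in> col_class c X i. s i \<noteq> a} = card (col_class c X i) - 1"
            using fin_class by simp
        qed
        finally have "card {p \<in> cycles_on X. \<forall>x\<in>X. c (p x) = g x} = fact (card (col_class c X w) - 1) *
           ((card (col_class c X i) - 1) * fact (card (col_class c X i) - 2) * E') * card T"
          by (simp add: mult_ac)
        moreover have "fact (card (col_class c X i) - 1) =
            (card (col_class c X i) - 1) * (fact (card (col_class c X i) - 2) :: nat)"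
          using True fact_reduce[of "card (col_class c X i) - 1", where 'a=nat]
          by (simp add: numeral_2_eq_2)
        ultimately show ?thesis by (intro goal) (simp add: E)
      next
        case False
        \<comment> \<open>Colour \<open>i\<close> disappears with its single point \<open>a\<close>.
          Only \<open>z\<close> has \<open>g\<close>-value \<open>i\<close>, so no tree arc enters
          \<open>i\<close>, which can be deleted as a leaf.\<close>
        then have "card (col_class c X i) = 1"
          using ne[of i] iR fin_class[of i] card_gt_0_iff[of "col_class c X i"] by auto
        then obtain a where a: "col_class c X i = {a}" by (auto simp: card_1_singleton_iff)
        have az: "a \<in> col_class c X i - {z}" using a Diff_z by blast
        have ai: "a \<in> X" "c a = i" using a by auto
        have "card (col_class g X i) = 1" using fib[of i] iR a by simp
        then have gz: "col_class g X i = {z}" using z by (intro card_1_eq) (simp_all add: i_def)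
        have g'i: "(g(z := g a)) x \<noteq> i" if "x \<in> X" for x
          using gz that ai az by (auto simp: i_def)
        have "card (F a) = (\<Prod>j\<in>insert w (R - {i}). fact (card (col_class c (X - {a}) j) - 1)) *
           card {s \<in> Pi\<^sub>E (R - {i}) (col_class c (X - {a})). tree (R - {i}) (\<lambda>j. (g(z := g a)) (s j))}"
          unfolding F[OF az]
        proof (rule less.hyps[OF smaller[OF az]])
          show "col_class c (X - {a}) j \<noteq> {}" if "j \<in> insert w (R - {i})" for j
            using that class'[of a j] ne[of j] az iw by auto
          show "c ` (X - {a}) \<subseteq> insert w (R - {i})" using cX a by auto
          show "(g(z := g a)) ` (X - {a}) \<subseteq> insert w (R - {i})" using g'X[OF az] g'i by blast
          show "card (col_class (g(z := g a)) (X - {a}) j) = card (col_class c (X - {a}) j)"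
            if "j \<in> insert w (R - {i})" for j
            by (rule fib'[OF az]) (use that in auto)
        qed (use fX fR wR in auto)
        also have "(\<Prod>j\<in>insert w (R - {i}). fact (card (col_class c (X - {a}) j) - 1))
            = fact (card (col_class c X w) - 1) * E'"
          using fR wR az class'[of a w] iw E'_class[of a] by simp
        also have "card {s \<in> Pi\<^sub>E (R - {i}) (col_class c (X - {a})).
            tree (R - {i}) (\<lambda>j. (g(z := g a)) (s j))} = card T"
        proof (rule bij_betw_same_card[OF bij_betw_byWitness])
          let ?T' = "{s \<in> Pi\<^sub>E (R - {i}) (col_class c (X - {a})).
            tree (R - {i}) (\<lambda>j. (g(z := g a)) (s j))}"
          have tr: "tree R (\<lambda>j. g (s j)) \<longleftrightarrow> tree (R - {i}) (\<lambda>j. (g(z := g a)) (s' j))"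
            if s: "s \<in> Pi\<^sub>E R (col_class c X)" and s': "\<And>j. j \<in> R - {i} \<Longrightarrow> s' j = s j" for s s'
          proof -
            have "tree R (\<lambda>j. g (s j)) \<longleftrightarrow> tree (R - {i}) (\<lambda>j. g (s j))"
            proof (rule tree_remove_leaf)
              fix m assume m: "m \<in> R"
              have "s m \<in> X" using s m by (auto simp: PiE_iff)
              then show "g (s m) \<noteq> i" using sz[OF s m] gz by auto
            qed
            also have "\<dots> \<longleftrightarrow> tree (R - {i}) (\<lambda>j. (g(z := g a)) (s' j))"
              by (rule tree_cong) (use sz[OF s] s' in simp)
            finally show ?thesis .
          qed
          \<comment> \<open>Selections are extensional, so dropping colour \<open>i\<close> means
            setting its value to \<open>undefined\<close>; \<open>a\<close> is the only value that
            can be restored.\<close>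
          have PiE1: "s(i := undefined) \<in> Pi\<^sub>E (R - {i}) (col_class c (X - {a}))"
            if "s \<in> Pi\<^sub>E R (col_class c X)" for s
            using that class'[of a] az by (auto simp: PiE_iff extensional_def)
          have PiE2: "s(i := a) \<in> Pi\<^sub>E R (col_class c X)"
            if "s \<in> Pi\<^sub>E (R - {i}) (col_class c (X - {a}))" for s
            using that ai iR by (auto simp: PiE_iff extensional_def)
          show "(\<lambda>s. s(i := a)) ` ?T' \<subseteq> T"
          proof (rule image_subsetI)
            fix s assume "s \<in> ?T'"
            then have s: "s \<in> Pi\<^sub>E (R - {i}) (col_class c (X - {a}))"
              "tree (R - {i}) (\<lambda>j. (g(z := g a)) (s j))" by blast+
            have "tree R (\<lambda>j. g ((s(i := a)) j))"
              by (rule tr[OF PiE2[OF s(1)], THEN iffD2, OF _ s(2)]) simp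
            then show "s(i := a) \<in> T" using PiE2[OF s(1)] by (simp only: T_def mem_Collect_eq)
          qed
          show "(\<lambda>s. s(i := undefined)) ` T \<subseteq> ?T'"
          proof (rule image_subsetI)
            fix s assume s: "s \<in> T"
            then have sP: "s \<in> Pi\<^sub>E R (col_class c X)" and "tree R (\<lambda>j. g (s j))"
              unfolding T_def by blast+
            then have "tree (R - {i}) (\<lambda>j. (g(z := g a)) ((s(i := undefined)) j))"
              by (intro tr[OF sP, THEN iffD1]) simp
            then show "s(i := undefined) \<in> ?T'" using PiE1[OF sP] by blast
          qed
          show "\<forall>s\<in>?T'. (s(i := a))(i := undefined) = s"
            by (auto simp: PiE_iff extensional_def)
          show "\<forall>s\<in>T. (s(i := undefined))(i := a) = s"
          proof
            fix s assume "s \<in> T"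
            then have "s i \<in> col_class c X i" using iR unfolding T_def PiE_iff by blast
            then show "(s(i := undefined))(i := a) = s" using a by auto
          qed
        qed
        finally have "card (F a) = fact (card (col_class c X w) - 1) * E' * card T" .
        moreover have "a \<noteq> z" using az by blast
        ultimately show ?thesis
          by (intro goal) (simp add: count Diff_z a E)
      qed
    qed
  qed
qed

lemma inv_cycles_on:
  assumes "finite X" "p \<in> cycles_on X"
  shows "inv p \<in> cycles_on X"
proof -
  have p: "p permutes X" "cyclic_on p X" using assms by (auto simp: cycles_on_def)
  then have "permutation p" using assms permutation_permutes by blast
  then show ?thesis
    using p by (simp add: cycles_on_def permutes_inv cyclic_on_def orbit_inv_eq)
qed

lemma bij_betw_inv_cycles_on: "finite X \<Longrightarrow> bij_betw inv (cycles_on X) (cycles_on X)"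
  by (rule bij_betw_byWitness[where f' = inv])
    (auto simp: inv_cycles_on, auto simp: cycles_on_def permutes_inv_inv)

text \<open>For fixed \<open>q\<close> the successor colours of \<open>p\<close> are given by the
  inverse of \<open>q\<close>, so the BEST-type count applies; summing over \<open>q\<close> brings
  in the tree count for each selection of arcs. For class sizes n_i the factors (n_i - 1)! and n_i
  combine to n_i!, and |X| - |R| is |X| + 1 - k for k colours.\<close>

lemma card_cycle_pairs_colour_preserving:
  fixes c :: "'a \<Rightarrow> 'k"
  assumes X: "finite X" "X \<noteq> {}"
  shows "card {(p, q). p \<in> cycles_on X \<and> q \<in> cycles_on X \<and> (\<forall>x\<in>X. c (p (q x)) = c x)}
      * (card X + 1 - card (c ` X))
    = fact (card X - 1) * (\<Prod>i\<in>c ` X. fact (card (col_class c X i)))"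
proof -
  let ?L = "cycles_on X"
  obtain w where w: "w \<in> c ` X" using X by auto
  define R where "R = c ` X - {w}"
  have R: "finite R" "w \<notin> R" "insert w R = c ` X" using X w by (auto simp: R_def)
  define S where "S = Pi\<^sub>E R (col_class c X)"
  define P where "P = (\<Prod>i\<in>c ` X. fact (card (col_class c X i) - 1) :: nat)"
  have finS: "finite S" unfolding S_def by (rule finite_PiE) (use R X in auto)
  have finL: "finite ?L" using X(1) by (rule finite_cycles_on)
  have "{(p, q). p \<in> ?L \<and> q \<in> ?L \<and> (\<forall>x\<in>X. c (p (q x)) = c x)}
      = (\<lambda>(q, p). (p, q)) ` (SIGMA q:?L. {p \<in> ?L. \<forall>x\<in>X. c (p (q x)) = c x})"
    by (auto simp: image_iff)
  then have "card {(p, q). p \<in> ?L \<and> q \<in> ?L \<and> (\<forall>x\<in>X. c (p (q x)) = c x)}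
      = card (SIGMA q:?L. {p \<in> ?L. \<forall>x\<in>X. c (p (q x)) = c x})"
    by (simp add: card_image inj_on_def split_beta prod_eq_iff)
  also have "\<dots> = (\<Sum>q\<in>?L. card {p \<in> ?L. \<forall>x\<in>X. c (p (q x)) = c x})"
    by (rule card_SigmaI) (use finL in auto)
  also have "\<dots> = (\<Sum>q\<in>?L. card {p \<in> ?L. \<forall>x\<in>X. c (p x) = c (inv q x)})"
  proof (intro sum.cong refl arg_cong[where f = card] Collect_cong conj_cong)
    fix p q assume "q \<in> ?L"
    then have q: "q permutes X" by (simp add: cycles_on_def)
    show "(\<forall>x\<in>X. c (p (q x)) = c x) \<longleftrightarrow> (\<forall>x\<in>X. c (p x) = c (inv q x))"
      using permutes_inverses[OF q] permutes_in_image[OF q] permutes_in_image[OF permutes_inv[OF q]]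
      by metis
  qed
  also have "\<dots> = (\<Sum>r\<in>?L. card {p \<in> ?L. \<forall>x\<in>X. c (p x) = c (r x)})"
    by (rule sum.reindex_bij_betw[OF bij_betw_inv_cycles_on[OF X(1)],
        of "\<lambda>r. card {p \<in> ?L. \<forall>x\<in>X. c (p x) = c (r x)}"])
  also have "\<dots> = (\<Sum>r\<in>?L. P * card {s \<in> S. tree R (\<lambda>i. c (r (s i)))})"
  proof (rule sum.cong[OF refl])
    fix r assume "r \<in> ?L"
    then have r: "r permutes X" by (simp add: cycles_on_def)
    show "card {p \<in> ?L. \<forall>x\<in>X. c (p x) = c (r x)} = P * card {s \<in> S. tree R (\<lambda>i. c (r (s i)))}"
      unfolding P_def S_def R(3)[symmetric]
    proof (rule card_cycles_colour_successors)
      show "card (col_class (\<lambda>x. c (r x)) X i) = card (col_class c X i)" for i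
        using card_filter_bij[OF permutes_imp_bij[OF r], of "\<lambda>x. c x = i"] by simp
      show "(\<lambda>x. c (r x)) ` X \<subseteq> insert w R" using R permutes_in_image[OF r] by auto
      show "col_class c X i \<noteq> {}" if "i \<in> insert w R" for i using that R by auto
    qed (use X R in auto)
  qed
  also have "\<dots> = P * (\<Sum>s\<in>S. card {r \<in> ?L. tree R (\<lambda>i. c (r (s i)))})"
    unfolding sum_distrib_left[symmetric]
    by (rule arg_cong[where f = "(*) P"], rule sum_multicount_gen) (use finS finL in auto)
  finally have count: "card {(p, q). p \<in> ?L \<and> q \<in> ?L \<and> (\<forall>x\<in>X. c (p (q x)) = c x)}
      = P * (\<Sum>s\<in>S. card {r \<in> ?L. tree R (\<lambda>i. c (r (s i)))})" .
  have cR: "card X + 1 - card (c ` X) = card X - card R"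
    using R by (metis Suc_eq_plus1 card_insert_disjoint diff_Suc_Suc)
  have root: "{x \<in> X. c x \<notin> R} = col_class c X w" by (auto simp: R_def)
  have "(\<Sum>s\<in>S. card {r \<in> ?L. tree R (\<lambda>i. c (r (s i)))}) * (card X - card R)
      = (\<Sum>s\<in>S. fact (card X - 1) * card (col_class c X w))"
    unfolding sum_distrib_right root[symmetric]
    by (intro sum.cong refl card_tree_cycles) (use X R in \<open>auto simp: S_def PiE_iff\<close>)
  \<comment> \<open>The selections contribute the class sizes over \<open>R\<close>, and the root
    points the remaining factor for \<open>w\<close>.\<close>
  also have "\<dots> = fact (card X - 1) * (\<Prod>i\<in>c ` X. card (col_class c X i))"
    unfolding R(3)[symmetric] using R(1,2) by (simp add: S_def card_PiE)
  finally have *: "(\<Sum>s\<in>S. card {r \<in> ?L. tree R (\<lambda>i. c (r (s i)))}) * (card X - card R)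
      = fact (card X - 1) * (\<Prod>i\<in>c ` X. card (col_class c X i))" .
  have fact_class: "fact (card (col_class c X i) - 1) * card (col_class c X i)
      = (fact (card (col_class c X i)) :: nat)" if "i \<in> c ` X" for i
  proof -
    have "card (col_class c X i) > 0" using X that by (auto simp: card_gt_0_iff)
    then show ?thesis
      using fact_reduce[of "card (col_class c X i)", where 'a=nat] by (simp add: mult.commute)
  qed
  have "P * (\<Sum>s\<in>S. card {r \<in> ?L. tree R (\<lambda>i. c (r (s i)))}) * (card X - card R)
      = fact (card X - 1) * (P * (\<Prod>i\<in>c ` X. card (col_class c X i)))"
    unfolding mult.assoc * by (simp only: mult_ac)
  also have "P * (\<Prod>i\<in>c ` X. card (col_class c X i)) = (\<Prod>i\<in>c ` X. fact (card (col_class c X i)))"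
    unfolding P_def prod.distrib[symmetric] by (rule prod.cong[OF refl fact_class])
  finally show ?thesis unfolding count cR .
qed

section \<open>Weighted colourings\<close>

text \<open>\<open>M\<close> collects the new colours. If \<open>c\<^sub>0\<close> uses all of
  \<open>T\<close> on \<open>A\<close>, the colour set of an extension is exactly
  \<open>T \<union> M\<close>, which fixes the denominator of the pair count.\<close>

definition extensions :: "('a \<Rightarrow> 'k) \<Rightarrow> 'a set \<Rightarrow> 'k set \<Rightarrow> 'a set \<Rightarrow> 'k set \<Rightarrow> ('a \<Rightarrow> 'k) set" where
  "extensions c\<^sub>0 A T D M = {c \<in> D \<rightarrow>\<^sub>E T \<union> M. (\<forall>x\<in>A. c x = c\<^sub>0 x) \<and> M \<subseteq> c ` D}"

lemma finite_extensions:
  "finite D \<Longrightarrow> finite T \<Longrightarrow> finite M \<Longrightarrow> finite (extensions c\<^sub>0 A T D M)"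
  unfolding extensions_def by (rule finite_subset[OF _ finite_PiE[of D "\<lambda>_. T \<union> M"]]) auto

lemma Suc_times_choose_Suc: "Suc k * (n choose Suc k) = (n - k) * (n choose k)"
  using binomial_absorption[of k n] binomial_absorb_comp[of n k] by simp

text \<open>The recurrence for adding one free point to \<open>n\<close> others, with
  \<open>m\<close> new colours and \<open>a\<close> standing for |A| + |T| - 1. It follows from
  absorption and Pascal's rule. For m = 0 the truncated index is harmless, as its term has the
  factor \<open>m\<close>.\<close>

lemma extensions_count_recurrence:
  "(n + 1) * ((n + 1 + a) choose (a + m))
    = (n + a + 1 + m) * ((n + a) choose (a + m)) + m * ((n + a) choose (a + m - 1))"
proof (cases m)
  case 0
  have "Suc a * ((n + a) choose Suc a) = n * ((n + a) choose a)"
    using Suc_times_choose_Suc[of a "n + a"] by simp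
  moreover have "(n + 1) * ((n + 1 + a) choose a) = (n + 1 + a) * ((n + a) choose a)"
    using binomial_absorb_comp[of "n + 1 + a" a] by simp
  ultimately show ?thesis using 0 by (simp add: algebra_simps)
next
  case (Suc k)
  have *: "(a + k + 1) * ((n + a) choose (a + k + 1)) = (n - k) * ((n + a) choose (a + k))"
    using Suc_times_choose_Suc[of "a + k" "n + a"] by simp
  have "(n + 1) * ((n + a) choose (a + k)) = (k + 1) * ((n + a) choose (a + k)) + (n - k) * ((n + a) choose (a + k))"
  proof (cases "k \<le> n")
    case True
    then have "n + 1 = (k + 1) + (n - k)" by simp
    then show ?thesis by (metis add_mult_distrib)
  qed (simp add: binomial_eq_0)
  then show ?thesis unfolding Suc *[symmetric] by (simp add: algebra_simps)
qed

lemma sum_card_col_class: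
  assumes "finite D" "finite K" "c ` D \<subseteq> K"
  shows "(\<Sum>i\<in>K. card (col_class c D i)) = card D"
proof -
  have "(\<Sum>i\<in>K. card (col_class c D i)) = (\<Sum>i\<in>K. \<Sum>x\<in>col_class c D i. 1)" by simp
  also have "\<dots> = (\<Sum>x\<in>D. 1)" by (rule sum.group) (use assms in auto)
  finally show ?thesis by simp
qed

lemma prod_fact_col_class_insert:
  assumes "finite D" "finite K" "x \<notin> D" "i \<in> K"
  shows "(\<Prod>k\<in>K. fact (card (col_class (c(x := i)) (insert x D) k)))
    = (\<Prod>k\<in>K. fact (card (col_class c D k))) * (card (col_class c D i) + 1 :: nat)"
proof -
  have "col_class (c(x := i)) (insert x D) i = insert x (col_class c D i)" using assms by auto
  then have i: "card (col_class (c(x := i)) (insert x D) i) = Suc (card (col_class c D i))"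
    using assms by simp
  have "col_class (c(x := i)) (insert x D) k = col_class c D k" if "k \<noteq> i" for k
    using assms that by auto
  then have "(\<Prod>k\<in>K - {i}. fact (card (col_class (c(x := i)) (insert x D) k)))
      = (\<Prod>k\<in>K - {i}. fact (card (col_class c D k)) :: nat)"
    by (intro prod.cong refl) simp
  then show ?thesis using assms i by (simp add: prod.remove[of K i] algebra_simps del: fun_upd_apply)
qed

text \<open>The new element either gets a colour of an extension already using all of \<open>M\<close>, or it is
  the only element of its colour \<open>i \<in> M\<close>.\<close>

lemma sum_extensions_insert:
  fixes M T :: "'k set" and c\<^sub>0 :: "'a \<Rightarrow> 'k"
  assumes fin: "finite D" "finite T" "finite M" and disj: "T \<inter> M = {}" and A: "A \<subseteq> D"
    and x: "x \<notin> D"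
  defines "W \<equiv> \<lambda>D M. \<Sum>c\<in>extensions c\<^sub>0 A T D M. \<Prod>k\<in>T \<union> M. fact (card (col_class c D k)) :: nat"
  shows "W (insert x D) M = (card D + card T + card M) * W D M + (\<Sum>i\<in>M. W D (M - {i}))"
proof -
  let ?E = "extensions c\<^sub>0 A T"
  let ?w = "\<lambda>D M c. \<Prod>k\<in>T \<union> M. fact (card (col_class c D k)) :: nat"
  let ?f = "\<lambda>(c, i). c(x := i)"
  let ?I1 = "?E D M \<times> (T \<union> M)"
  let ?I2 = "SIGMA i:M. ?E D (M - {i})"
  let ?g = "\<lambda>(i, c). c(x := i)"
  have xA: "x \<notin> A" using A x by auto
  \<comment> \<open>Extensionality makes \<open>c\<close> undefined at the new point, so an updated
    colouring determines both the old one and the added colour.\<close>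
  have ext: "c x = undefined" if "c \<in> ?E D M'" for c M'
    using that x by (auto simp: extensions_def PiE_def extensional_def)
  have undo: "(c(x := i))(x := undefined) = c" if "c \<in> ?E D M'" for c i M'
    using ext[OF that] by auto
  have inj1: "inj_on ?f ?I1"
  proof (rule inj_onI)
    fix u v assume uv: "u \<in> ?I1" "v \<in> ?I1" "?f u = ?f v"
    then have "?f u x = ?f v x" "(?f u)(x := undefined) = (?f v)(x := undefined)" by simp_all
    then show "u = v" using uv(1,2) undo by (cases u, cases v) auto
  qed
  have inj2: "inj_on ?g ?I2"
  proof (rule inj_onI)
    fix u v assume uv: "u \<in> ?I2" "v \<in> ?I2" "?g u = ?g v"
    then have "?g u x = ?g v x" "(?g u)(x := undefined) = (?g v)(x := undefined)" by simp_all
    then show "u = v" using uv(1,2) undo by (cases u, cases v) auto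
  qed
  have img: "c(x := i) ` D = c ` D" for c :: "'a \<Rightarrow> 'k" and i using x by (intro image_cong) auto
  have sub1: "c(x := i) \<in> ?E (insert x D) M" if "c \<in> ?E D M" "i \<in> T \<union> M" for c i
    using that xA x img[of c i] unfolding extensions_def
    by (auto simp: PiE_iff extensional_def simp del: fun_upd_apply) (auto)
  have sub2: "c(x := i) \<in> ?E (insert x D) M" if "i \<in> M" "c \<in> ?E D (M - {i})" for c i
    using that xA x img[of c i] unfolding extensions_def
    by (auto simp: PiE_iff extensional_def simp del: fun_upd_apply) (auto)
  have eq: "?E (insert x D) M = ?f ` ?I1 \<union> ?g ` ?I2"
  proof (intro subset_antisym subsetI)
    fix c assume c: "c \<in> ?E (insert x D) M"
    define c' where "c' = c(x := undefined)"
    have cx: "c x \<in> T \<union> M" using c by (auto simp: extensions_def)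
    have img': "c' ` D = c ` D" unfolding c'_def by (rule img)
    have c': "c' \<in> D \<rightarrow>\<^sub>E T \<union> M" "\<forall>x\<in>A. c' x = c\<^sub>0 x"
      using c xA x by (auto simp: extensions_def c'_def PiE_iff extensional_def)
    show "c \<in> ?f ` ?I1 \<union> ?g ` ?I2"
    proof (cases "M \<subseteq> c ` D")
      case True
      then have "c' \<in> ?E D M" using c' img' by (simp add: extensions_def)
      then have I1: "(c', c x) \<in> ?I1" using cx by blast
      show ?thesis by (rule UnI1, rule image_eqI[OF _ I1]) (simp add: c'_def)
    next
      case False
      have M: "M \<subseteq> insert (c x) (c ` D)" using c by (auto simp: extensions_def)
      \<comment> \<open>A new colour missing on \<open>D\<close> can only be that of
        \<open>x\<close>, and no other point shares it.\<close>
      then have cxM: "c x \<in> M" "c x \<notin> c ` D" "M - {c x} \<subseteq> c ` D" using False by auto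
      have "c' v \<in> T \<union> (M - {c x})" if "v \<in> D" for v
      proof -
        have "c' v = c v" using that x by (auto simp: c'_def)
        moreover have "c v \<noteq> c x" using that cxM by (metis imageI)
        ultimately show ?thesis using PiE_mem[OF c'(1) that] by auto
      qed
      then have "c' \<in> ?E D (M - {c x})"
        using c' cxM img' by (simp add: extensions_def PiE_iff)
      then have I2: "(c x, c') \<in> ?I2" using cxM by blast
      show ?thesis by (rule UnI2, rule image_eqI[OF _ I2]) (simp add: c'_def)
    qed
  qed (use sub1 sub2 in auto)
  have disj': "?f ` ?I1 \<inter> ?g ` ?I2 = {}"
  proof -
    have False if c: "c \<in> ?E D M" and c': "i \<in> M" "c' \<in> ?E D (M - {i})" and e: "c(x := k) = c'(x := i)"
      for c c' i k
    proof -
      have "c = c'" using undo[OF c, of k] undo[OF c'(2), of i] e by simp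
      then have "i \<in> c' ` D" using c c'(1) unfolding extensions_def by blast
      moreover have "c' ` D \<subseteq> T \<union> (M - {i})" using c'(2) unfolding extensions_def by blast
      ultimately show False using disj c'(1) by blast
    qed
    note clash = this
    show ?thesis
    proof (rule equals0I)
      fix v assume "v \<in> ?f ` ?I1 \<inter> ?g ` ?I2"
      then show False
      proof (elim IntE imageE)
        fix a b assume "v = ?f a" "v = ?g b" "a \<in> ?I1" "b \<in> ?I2"
        then show False using clash[of "fst a" "fst b" "snd b" "snd a"]
          by (simp add: case_prod_unfold mem_Times_iff mem_Sigma_iff[of "fst b" "snd b", simplified])
      qed
    qed
  qed
  have finE: "finite (?E D M')" if "M' \<subseteq> M" for M'
    using finite_extensions[OF fin(1,2)] finite_subset[OF that fin(3)] by simp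
  have fins: "finite ?I1" "finite ?I2" using fin finE by auto
  have "W (insert x D) M = (\<Sum>u\<in>?I1. ?w (insert x D) M (?f u)) + (\<Sum>u\<in>?I2. ?w (insert x D) M (?g u))"
    unfolding W_def eq
    by (subst sum.union_disjoint) (use fins disj' in \<open>simp_all add: sum.reindex[OF inj1] sum.reindex[OF inj2] o_def\<close>)
  also have "(\<Sum>u\<in>?I1. ?w (insert x D) M (?f u)) = (card D + card T + card M) * W D M"
  proof -
    have "(\<Sum>u\<in>?I1. ?w (insert x D) M (?f u))
        = (\<Sum>c\<in>?E D M. \<Sum>i\<in>T \<union> M. ?w (insert x D) M (c(x := i)))"
      by (subst sum.cartesian_product) (simp add: case_prod_unfold)
    also have "\<dots> = (\<Sum>c\<in>?E D M. ?w D M c * (card D + card T + card M))"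
    proof (rule sum.cong[OF refl])
      fix c assume c: "c \<in> ?E D M"
      \<comment> \<open>Giving \<open>x\<close> colour \<open>i\<close> multiplies the weight by the
        class size plus 1; these factors add up to |D| + |T| + |M|.\<close>
      have "(\<Sum>i\<in>T \<union> M. ?w (insert x D) M (c(x := i)))
          = (\<Sum>i\<in>T \<union> M. ?w D M c * (card (col_class c D i) + 1))"
        by (rule sum.cong[OF refl], rule prod_fact_col_class_insert) (use fin x in auto)
      also have "\<dots> = ?w D M c * ((\<Sum>i\<in>T \<union> M. card (col_class c D i)) + card (T \<union> M))"
        by (simp only: sum_distrib_left[symmetric] sum.distrib) simp
      also have "(\<Sum>i\<in>T \<union> M. card (col_class c D i)) = card D"
        by (rule sum_card_col_class) (use fin c in \<open>auto simp: extensions_def\<close>)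
      also have "card (T \<union> M) = card T + card M" by (rule card_Un_disjoint[OF fin(2,3) disj])
      finally show "(\<Sum>i\<in>T \<union> M. ?w (insert x D) M (c(x := i)))
          = ?w D M c * (card D + card T + card M)" by (simp add: add.assoc)
    qed
    finally show ?thesis unfolding W_def sum_distrib_right[symmetric] by (simp only: mult.commute)
  qed
  also have "(\<Sum>u\<in>?I2. ?w (insert x D) M (?g u)) = (\<Sum>i\<in>M. W D (M - {i}))"
  proof -
    have "(\<Sum>u\<in>?I2. ?w (insert x D) M (?g u))
        = (\<Sum>i\<in>M. \<Sum>c\<in>?E D (M - {i}). ?w (insert x D) M (c(x := i)))"
      by (subst sum.Sigma) (use fin finE in \<open>auto simp: case_prod_unfold\<close>)
    also have "\<dots> = (\<Sum>i\<in>M. W D (M - {i}))"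
      unfolding W_def
    proof (intro sum.cong refl)
      fix i c assume i: "i \<in> M" and c: "c \<in> ?E D (M - {i})"
      have "c ` D \<subseteq> T \<union> (M - {i})" using c by (auto simp: extensions_def)
      \<comment> \<open>The class of the fresh colour grows from 0 to 1, and 0! = 1!, so the weight
        does not change.\<close>
      then have no_i: "col_class c D i = {}" using disj i by blast
      have "?w (insert x D) M (c(x := i)) = ?w D M c * (card (col_class c D i) + 1)"
        by (rule prod_fact_col_class_insert) (use fin x i in auto)
      also have "\<dots> = ?w D M c" by (simp only: no_i card.empty add_0 mult_1_right)
      also have "\<dots> = (\<Prod>k\<in>insert i (T \<union> (M - {i})). fact (card (col_class c D k)))"
        by (rule prod.cong) (use i in auto)
      also have "\<dots> = fact (card (col_class c D i)) * ?w D (M - {i}) c"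
        by (rule prod.insert) (use fin i disj in auto)
      also have "\<dots> = ?w D (M - {i}) c" by (simp only: no_i card.empty fact_0 mult_1)
      finally show "?w (insert x D) M (c(x := i)) = ?w D (M - {i}) c" .
    qed
    finally show ?thesis .
  qed
  finally show ?thesis .
qed

text \<open>The points of \<open>F\<close> are added one at a time, and both sides obey
  \<open>extensions_count_recurrence\<close>. Without free points only \<open>c\<^sub>0\<close> on
  \<open>A\<close> remains, so no new colour occurs, and the binomial vanishes for nonempty
  \<open>M\<close>. As \<open>T\<close> is nonempty, the subtractions of 1 are not
  truncated.\<close>

lemma sum_extensions:
  fixes M T :: "'k set" and c\<^sub>0 :: "'a \<Rightarrow> 'k"
  assumes fin: "finite A" "finite F" "finite T" "finite M" and T: "T \<noteq> {}" "c\<^sub>0 ` A \<subseteq> T"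
    and disj: "T \<inter> M = {}" "A \<inter> F = {}"
  shows "(\<Sum>c\<in>extensions c\<^sub>0 A T (A \<union> F) M. \<Prod>k\<in>T \<union> M. fact (card (col_class c (A \<union> F) k)))
    = (\<Prod>k\<in>T. fact (card (col_class c\<^sub>0 A k))) * fact (card F)
      * ((card F + card A + card T - 1) choose (card A + card T + card M - 1) :: nat)"
  using fin(2,4) disj
proof (induction F arbitrary: M rule: finite_induct)
  case empty
  have t: "card T \<ge> 1" using T fin by (simp add: card_gt_0_iff Suc_le_eq)
  show ?case
  proof (cases "M = {}")
    case True
    have "extensions c\<^sub>0 A T A {} = {restrict c\<^sub>0 A}"
      using T by (auto simp: extensions_def PiE_iff extensional_def fun_eq_iff restrict_def)
    moreover have "col_class (restrict c\<^sub>0 A) A k = col_class c\<^sub>0 A k" for k by auto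
    ultimately show ?thesis using True by simp
  next
    case False
    have "extensions c\<^sub>0 A T A M = {}"
    proof (rule equals0I)
      fix c assume c: "c \<in> extensions c\<^sub>0 A T A M"
      then have "c ` A = c\<^sub>0 ` A" by (intro image_cong) (auto simp: extensions_def)
      then have "M \<subseteq> T" using c T unfolding extensions_def by blast
      then show False using False empty by blast
    qed
    moreover have "card M \<ge> 1" using False empty by (simp add: card_gt_0_iff Suc_le_eq)
    ultimately show ?thesis using t by (simp add: binomial_eq_0)
  qed
next
  case (insert x F)
  define a where "a = card A + card T - 1"
  have t: "card T \<ge> 1" using T fin by (simp add: card_gt_0_iff Suc_le_eq)
  define P where "P = (\<Prod>k\<in>T. fact (card (col_class c\<^sub>0 A k)) :: nat)"
  let ?W = "\<lambda>D M. \<Sum>c\<in>extensions c\<^sub>0 A T D M. \<Prod>k\<in>T \<union> M. fact (card (col_class c D k)) :: nat"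
  have IH: "?W (A \<union> F) M' = P * fact (card F) * ((card F + a) choose (a + card M'))" if "M' \<subseteq> M" for M'
  proof -
    have "?W (A \<union> F) M' = P * fact (card F)
      * ((card F + card A + card T - 1) choose (card A + card T + card M' - 1))"
      unfolding P_def by (rule insert.IH) (use insert.prems that finite_subset in blast)+
    moreover have "card F + card A + card T - 1 = card F + a"
      "card A + card T + card M' - 1 = a + card M'" using t by (simp_all add: a_def)
    ultimately show ?thesis by (simp only:)
  qed
  have "?W (insert x (A \<union> F)) M = (card (A \<union> F) + card T + card M) * ?W (A \<union> F) M
      + (\<Sum>i\<in>M. ?W (A \<union> F) (M - {i}))"
    by (rule sum_extensions_insert) (use insert fin in auto)
  also have "(\<Sum>i\<in>M. ?W (A \<union> F) (M - {i}))
      = (\<Sum>i\<in>M. P * fact (card F) * ((card F + a) choose (a + card M - 1)))"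
  proof (rule sum.cong[OF refl])
    fix i assume i: "i \<in> M"
    have "card M \<ge> 1" using i insert.prems by (auto simp: card_gt_0_iff Suc_le_eq)
    then have "a + card (M - {i}) = a + card M - 1" using i insert.prems by simp
    then show "?W (A \<union> F) (M - {i}) = P * fact (card F) * ((card F + a) choose (a + card M - 1))"
      by (subst IH) auto
  qed
  also have "card (A \<union> F) = card A + card F"
    using fin insert by (intro card_Un_disjoint) auto
  finally have "?W (insert x (A \<union> F)) M = P * fact (card F) *
     ((card F + a + 1 + card M) * ((card F + a) choose (a + card M))
      + card M * ((card F + a) choose (a + card M - 1)))"
  proof -
    assume *: "?W (insert x (A \<union> F)) M = (card A + card F + card T + card M) * ?W (A \<union> F) M
      + (\<Sum>i\<in>M. P * fact (card F) * ((card F + a) choose (a + card M - 1)))"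
    have "card A + card F + card T + card M = card F + a + 1 + card M" using t by (simp add: a_def)
    then show ?thesis unfolding * IH[OF order_refl] sum_constant of_nat_id
      by (simp only: distrib_left distrib_right mult_ac add_ac)
  qed
  also have "\<dots> = P * fact (card (insert x F)) * ((card (insert x F) + a) choose (a + card M))"
    unfolding extensions_count_recurrence[symmetric] card_insert_disjoint[OF insert.hyps] fact_Suc of_nat_id
    by (simp only: Suc_eq_plus1 mult_ac)
  also have "card (insert x F) + a = card (insert x F) + card A + card T - 1"
    using t by (simp add: a_def)
  also have "a + card M = card A + card T + card M - 1" using t by (simp add: a_def)
  also have "insert x (A \<union> F) = A \<union> insert x F" by simp
  finally show ?case unfolding P_def .
qed

section \<open>The alternating sum\<close>

lemma falling_factorial_nat:
  "k \<le> n \<Longrightarrow> falling_factorial (real n) k = fact n / fact (n - k)"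
proof (induction k)
  case 0
  then show ?case by (simp add: falling_factorial_def)
next
  case (Suc k)
  have "falling_factorial (real n) (Suc k) = falling_factorial (real n) k * real (n - k)"
    using Suc.prems by (simp add: falling_factorial_def)
  also have "\<dots> = fact n / fact (n - k) * real (n - k)" using Suc by simp
  also have "(fact (n - k) :: real) = real (n - k) * fact (n - Suc k)"
    using Suc.prems fact_reduce[of "n - k", where 'a=real] by simp
  also have "fact n / (real (n - k) * fact (n - Suc k)) * real (n - k) = fact n / fact (n - Suc k)"
    using Suc.prems by simp
  finally show ?case .
qed

text \<open>\<open>m\<close> counts the new colours, and the denominator is N - k + 1 for k = t + m
  colours. The generalised binomial is q - t over m, evaluated at q = 1.\<close>

definition alt_sum :: "nat \<Rightarrow> nat \<Rightarrow> nat \<Rightarrow> real" where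
  "alt_sum N t n = (\<Sum>m\<le>n. ((1 - real t) gchoose m) * real ((N + t - 1) choose (n - m))
     / (real N + 1 - real t - real m))"

text \<open>The right-hand side carries the denominator of the alternating sum as a factor, so
  division removes it. The relation rests on absorption and Pascal's rule, and its first coefficient
  vanishes at n = N - t.\<close>

lemma alt_sum_summand:
  assumes "t \<ge> 1" "m \<le> n" "n \<le> N"
  shows "(real N + 1 - real t - real (Suc n)) * real ((N + t - 1) choose (Suc n - m))
      + (2 * real N - real n) * real ((N + t - 1) choose (n - m))
    = (real N + 1 - real t - real m) * real ((N + t) choose (Suc n - m))"
proof -
  define k where "k = n - m"
  define M where "M = N + t - 1"
  have n: "n = m + k" "Suc n - m = Suc k" using assms by (auto simp: k_def)
  have M: "N + t = Suc M" "real M = real N + real t - 1" "k \<le> M"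
    using assms by (auto simp: M_def k_def)
  have "Suc k * (M choose Suc k) = (M - k) * (M choose k)"
    using binomial_absorption[of k M] binomial_absorb_comp[of M k] by simp
  then have "real (Suc k) * real (M choose Suc k) = (real M - real k) * real (M choose k)"
    using M(3) by (metis of_nat_diff of_nat_mult)
  then have *: "(real k + 1) * real (M choose Suc k) = (real N + real t - 1 - real k) * real (M choose k)"
    using M by (simp add: add.commute)
  have "(real N + 1 - real t - real (Suc n)) * real (M choose Suc k) + (2 * real N - real n) * real (M choose k)
    = (real N + 1 - real t - real m) * (real (M choose Suc k) + real (M choose k))
      - ((real k + 1) * real (M choose Suc k) - (real N + real t - 1 - real k) * real (M choose k))"
    unfolding n(1) by (simp add: algebra_simps)
  also have "\<dots> = (real N + 1 - real t - real m) * real ((N + t) choose Suc k)"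
    unfolding * M(1) by simp
  finally show ?thesis unfolding n(2) M_def[symmetric] k_def[symmetric] .
qed

text \<open>Vandermonde convolution: the upper entries 1 - t and N + t add up to N + 1.\<close>

lemma sum_gchoose_choose:
  "(\<Sum>m\<le>n. ((1 - real t) gchoose m) * real ((N + t) choose (n - m))) = real ((N + 1) choose n)"
  using gbinomial_Vandermonde[of "1 - real t" "real (N + t)" n]
  by (simp add: binomial_gbinomial atMost_atLeast0)

text \<open>Summing the termwise relation, divided by the denominators, leaves a Vandermonde sum.
  The bound on \<open>n\<close> keeps all denominators nonzero.\<close>

lemma alt_sum_rec:
  assumes "t \<ge> 1" "Suc n + t \<le> N"
  shows "(real N - real t - real n) * alt_sum N t (Suc n) + (2 * real N - real n) * alt_sum N t n
    = real ((N + 1) choose Suc n)"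
proof -
  let ?a = "\<lambda>m. (1 - real t) gchoose m"
  let ?d = "\<lambda>m. real N + 1 - real t - real m"
  let ?C = "\<lambda>n m. real ((N + t - 1) choose (n - m))"
  have "(real N - real t - real n) * alt_sum N t (Suc n) + (2 * real N - real n) * alt_sum N t n
    = (\<Sum>m\<le>n. (real N - real t - real n) * (?a m * ?C (Suc n) m / ?d m))
      + (\<Sum>m\<le>n. (2 * real N - real n) * (?a m * ?C n m / ?d m))
      + (real N - real t - real n) * (?a (Suc n) / ?d (Suc n))"
    by (simp add: alt_sum_def sum_distrib_left algebra_simps)
  also have "(\<Sum>m\<le>n. (real N - real t - real n) * (?a m * ?C (Suc n) m / ?d m))
      + (\<Sum>m\<le>n. (2 * real N - real n) * (?a m * ?C n m / ?d m))
    = (\<Sum>m\<le>n. ?a m * real ((N + t) choose (Suc n - m)))"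
    unfolding sum.distrib[symmetric]
  proof (rule sum.cong[OF refl])
    fix m assume m: "m \<in> {..n}"
    have "?d m \<noteq> 0" using m assms by simp
    moreover have "(real N - real t - real n) * ?C (Suc n) m + (2 * real N - real n) * ?C n m
        = ?d m * real ((N + t) choose (Suc n - m))"
    proof -
      have "real N - real t - real n = real N + 1 - real t - real (Suc n)" by simp
      then show ?thesis using alt_sum_summand[of t m n N] m assms by (simp only:) simp
    qed
    ultimately have "?a m * ((real N - real t - real n) * ?C (Suc n) m + (2 * real N - real n) * ?C n m) / ?d m
        = ?a m * real ((N + t) choose (Suc n - m))" by simp
    then show "(real N - real t - real n) * (?a m * ?C (Suc n) m / ?d m)
        + (2 * real N - real n) * (?a m * ?C n m / ?d m) = ?a m * real ((N + t) choose (Suc n - m))"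
      by (simp only: times_divide_eq_right add_divide_distrib distrib_left mult.left_commute)
  qed
  \<comment> \<open>For m = n + 1 the denominator equals the leading coefficient, so the extra term
    is exactly the last summand of the convolution.\<close>
  also have "(real N - real t - real n) * (?a (Suc n) / ?d (Suc n)) = ?a (Suc n)"
  proof -
    have e: "?d (Suc n) = real N - real t - real n" by simp
    have "real N - real t - real n \<noteq> 0" using assms by simp
    then show ?thesis unfolding e by simp
  qed
  also have "(\<Sum>m\<le>n. ?a m * real ((N + t) choose (Suc n - m))) + ?a (Suc n)
      = (\<Sum>m\<le>Suc n. ?a m * real ((N + t) choose (Suc n - m)))" by simp
  finally show ?thesis unfolding sum_gchoose_choose .
qed

text \<open>At n = N - t the termwise relation evaluates the sum itself, as its first coefficient is
  zero and 2N - n = N + t. What remains is a Vandermonde sum without its last term, and that term is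
  the signed binomial.\<close>

lemma alt_sum_last:
  assumes "t \<ge> 1" "t \<le> N"
  shows "(real N + real t) * alt_sum N t (N - t)
    = real ((N + 1) choose t) + (-1) ^ (N + t) * real (int_binomial (N - 1) (int t - 2))"
proof -
  let ?a = "\<lambda>m. (1 - real t) gchoose m"
  define n where "n = N - t"
  have n: "real n = real N - real t" "n \<le> N" using assms by (auto simp: n_def)
  have "(real N + real t) * alt_sum N t n = (\<Sum>m\<le>n. ?a m * real ((N + t) choose (Suc n - m)))"
    unfolding alt_sum_def sum_distrib_left
  proof (rule sum.cong[OF refl])
    fix m assume m: "m \<in> {..n}"
    have "real N + 1 - real t - real m \<noteq> 0" using m n by simp
    moreover have "(real N + real t) * real ((N + t - 1) choose (n - m))
        = (real N + 1 - real t - real m) * real ((N + t) choose (Suc n - m))"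
      using alt_sum_summand[of t m n N] m assms n by simp
    ultimately show "(real N + real t) * (?a m * real ((N + t - 1) choose (n - m)) / (real N + 1 - real t - real m))
        = ?a m * real ((N + t) choose (Suc n - m))"
      by (simp only: times_divide_eq_right mult.left_commute[of "real N + real t"] nonzero_mult_div_cancel_left)
        (simp only: mult.left_commute[of "?a m"] nonzero_mult_div_cancel_left not_False_eq_True)
  qed
  also have "\<dots> = real ((N + 1) choose Suc n) - ?a (Suc n)"
    unfolding sum_gchoose_choose[of t N "Suc n", symmetric] by simp
  also have "(N + 1) choose Suc n = (N + 1) choose t"
    using assms binomial_symmetric[of t "N + 1"] by (simp add: n_def Suc_diff_le)
  \<comment> \<open>Negating the upper entry turns 1 - t over n + 1 into N - 1 over n + 1 up to
    sign, because n + 1 = N - t + 1.\<close>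
  also have "?a (Suc n) = (-1) ^ Suc n * real ((N - 1) choose Suc n)"
  proof -
    have "real (Suc n) - (1 - real t) - 1 = real (N - 1)" using assms n by simp
    then show ?thesis
      using gbinomial_negated_upper[of "1 - real t" "Suc n"] by (simp only: binomial_gbinomial)
  qed
  \<comment> \<open>By symmetry the lower index becomes t - 2; for t = 1 that is -1 and both sides
    are zero.\<close>
  also have "(N - 1) choose Suc n = int_binomial (N - 1) (int t - 2)"
  proof (cases "t = 1")
    case True
    then show ?thesis using assms by (simp add: n_def int_binomial_def)
  next
    case False
    then have "N - 1 - (t - 2) = Suc n" "t - 2 \<le> N - 1" "nat (int t - 2) = t - 2"
      using assms by (auto simp: n_def)
    then show ?thesis using False assms binomial_symmetric[of "t - 2" "N - 1"]
      by (simp add: int_binomial_def)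
  qed
  also have "(-1) ^ Suc n = - ((-1) ^ (N + t) :: real)"
  proof -
    have "N + t = n + 2 * t" using assms by (simp add: n_def)
    then show ?thesis by (simp add: power_add power_mult)
  qed
  finally show ?thesis by (simp add: n_def)
qed

text \<open>The sum of the theorem, with the falling factorials written as quotients of factorials up to the
  constant factor \<open>(N - 1)! / (N - t)!\<close>.\<close>

definition pos_sum :: "nat \<Rightarrow> nat \<Rightarrow> nat \<Rightarrow> real" where
  "pos_sum N t l = (\<Sum>\<nu>\<le>l - t. fact (N + l - \<nu> - 1) * fact (N - t - \<nu>)
     / (fact (N - 1 - \<nu>) * fact (l - t - \<nu>)))"

text \<open>The combination of the two summands is minus the increment from \<open>\<nu>\<close> to \<open>\<nu> + 1\<close> of
  \<open>(N + l - \<nu>)! (N - t + 1 - \<nu>)! / ((N - 1 - \<nu>)! (l + 1 - t - \<nu>)!)\<close>.\<close>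

lemma pos_sum_rec:
  assumes "t \<ge> 1" "t \<le> l" "l < N"
  shows "(real N - real l) * pos_sum N t (Suc l) + (real l + 1) * pos_sum N t l
    = fact (N + l) * fact (N - t + 1) / (fact (N - 1) * fact (Suc l - t))"
proof -
  define G :: "nat \<Rightarrow> real" where "G = (\<lambda>\<nu>. fact (N + l - \<nu>) * fact (N - t + 1 - \<nu>)
      / (fact (N - 1 - \<nu>) * fact (Suc l - t - \<nu>)))"
  define u :: "nat \<Rightarrow> nat \<Rightarrow> real" where "u = (\<lambda>l \<nu>. fact (N + l - \<nu> - 1) * fact (N - t - \<nu>)
     / (fact (N - 1 - \<nu>) * fact (l - t - \<nu>)))"
  have step: "(real N - real l) * u (Suc l) \<nu> + (real l + 1) * u l \<nu> = G \<nu> - G (Suc \<nu>)"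
    if "\<nu> \<le> l - t" for \<nu>
  proof -
    \<comment> \<open>Expressing \<open>N\<close>, \<open>l\<close> and \<open>t\<close> through
      \<open>s\<close>, \<open>b\<close>, \<open>d\<close> and \<open>\<nu>\<close> removes all
      natural subtractions; the four terms then share the denominator \<open>D\<close>.\<close>
    define b where "b = l - t - \<nu>"
    have b: "l = t + \<nu> + b" using that assms by (simp add: b_def)
    obtain d where d: "N = Suc (l + d)" using assms less_imp_Suc_add by blast
    obtain s where s: "t = Suc s" using assms by (cases t) auto
    define X where "X = s + b + d"
    define Y where "Y = s + b + Suc (l + d)"
    have e: "N + Suc l - \<nu> - 1 = Suc Y" "N + l - \<nu> - 1 = Y" "N - t - \<nu> = Suc (b + d)"
       "N - 1 - \<nu> = Suc X" "Suc l - t - \<nu> = Suc b" "l - t - \<nu> = b" "N + l - \<nu> = Suc Y"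
       "N - t + 1 - \<nu> = Suc (Suc (b + d))" "N + l - Suc \<nu> = Y" "N - t + 1 - Suc \<nu> = Suc (b + d)"
       "N - 1 - Suc \<nu> = X" "Suc l - t - Suc \<nu> = b"
      using b d s by (simp_all add: X_def Y_def)
    define fX fY fb fd where f: "fX = (fact X :: real)" "fY = (fact Y :: real)" "fb = (fact b :: real)"
      "fd = (fact (Suc (b + d)) :: real)"
    have nz: "fX \<noteq> 0" "fb \<noteq> 0" by (auto simp: f)
    define D where "D = (real X + 1) * fX * ((real b + 1) * fb)"
    have pos: "real X + 1 \<noteq> 0" "real b + 1 \<noteq> 0" by linarith+
    have u1: "u (Suc l) \<nu> = fY * fd * (real Y + 1) / D"
      unfolding u_def e D_def by (simp add: f add.commute mult_ac)
    have u0: "u l \<nu> = fY * fd * (real b + 1) / D"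
    proof -
      have "u l \<nu> = fY * fd / ((real X + 1) * fX * fb)"
        unfolding u_def e by (simp add: f add.commute mult_ac)
      then show ?thesis using pos by (simp add: D_def)
    qed
    have g0: "G \<nu> = fY * fd * ((real Y + 1) * (real b + real d + 2)) / D"
    proof -
      have "(fact (Suc (Suc (b + d))) :: real) = (real b + real d + 2) * fd"
        unfolding f fact_Suc[of "Suc (b + d)"] by simp
      then show ?thesis unfolding G_def e D_def by (simp add: f add.commute mult_ac del: fact_Suc) (simp add: mult_ac)
    qed
    have g1: "G (Suc \<nu>) = fY * fd * ((real X + 1) * (real b + 1)) / D"
    proof -
      have "G (Suc \<nu>) = fY * fd / (fX * fb)" unfolding G_def e by (simp add: f)
      then show ?thesis using pos by (simp add: D_def)
    qed
    have "(real N - real l) * (real Y + 1) + (real l + 1) * (real b + 1)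
        = (real Y + 1) * (real b + real d + 2) - (real X + 1) * (real b + 1)"
      using b d s by (simp add: X_def Y_def algebra_simps)
    then have key: "(real N - real l) * (fY * fd * (real Y + 1)) + (real l + 1) * (fY * fd * (real b + 1))
        = fY * fd * ((real Y + 1) * (real b + real d + 2)) - fY * fd * ((real X + 1) * (real b + 1))"
      by (simp only: mult.left_commute[of _ "fY * fd"] distrib_left[symmetric] right_diff_distrib[symmetric])
    show ?thesis
      unfolding u1 u0 g0 g1 times_divide_eq_right add_divide_distrib[symmetric]
        diff_divide_distrib[symmetric] key ..
  qed
  \<comment> \<open>The sum for \<open>Suc l\<close> has one term more than that for
    \<open>l\<close>; it equals the end value of \<open>G\<close> and cancels the remainder of the
    telescoping.\<close>
  have last: "(real N - real l) * u (Suc l) (Suc l - t) = G (Suc l - t)"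
  proof -
    obtain d where d: "N = Suc (l + d)" using assms less_imp_Suc_add by blast
    have e: "N - t + 1 - (Suc l - t) = Suc d" "N - t - (Suc l - t) = d"
      "N + Suc l - (Suc l - t) - 1 = N + l - (Suc l - t)"
      using assms d by auto
    show ?thesis unfolding u_def G_def e using d by simp
  qed
  have "(real N - real l) * pos_sum N t (Suc l) + (real l + 1) * pos_sum N t l
      = (real N - real l) * (\<Sum>\<nu>\<le>l - t. u (Suc l) \<nu>) + (real l + 1) * (\<Sum>\<nu>\<le>l - t. u l \<nu>)
        + (real N - real l) * u (Suc l) (Suc l - t)"
  proof -
    have ps: "pos_sum N t k = (\<Sum>\<nu>\<le>k - t. u k \<nu>)" for k by (simp only: pos_sum_def u_def)
    have S: "Suc l - t = Suc (l - t)" using assms by simp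
    show ?thesis unfolding ps S by (simp add: distrib_left)
  qed
  also have "(real N - real l) * (\<Sum>\<nu>\<le>l - t. u (Suc l) \<nu>) + (real l + 1) * (\<Sum>\<nu>\<le>l - t. u l \<nu>)
      = (\<Sum>\<nu>\<le>l - t. G \<nu> - G (Suc \<nu>))"
    unfolding sum_distrib_left sum.distrib[symmetric] by (rule sum.cong[OF refl]) (use step in auto)
  also have "\<dots> = G 0 - G (Suc (l - t))" by (rule sum_telescope)
  also have "Suc (l - t) = Suc l - t" using assms by simp
  also have "G 0 - G (Suc l - t) + (real N - real l) * u (Suc l) (Suc l - t) = G 0"
    using last by simp
  finally show ?thesis by (simp add: G_def)
qed

section \<open>The closed form of the alternating sum\<close>

text \<open>The bracket of the theorem divided by N + t, which makes it directly comparable with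
  \<open>alt_sum\<close>.\<close>

definition closed_form :: "nat \<Rightarrow> nat \<Rightarrow> nat \<Rightarrow> real" where
  "closed_form N t l = (-1) ^ (N + l) * real (int_binomial (N - 1) (int t - 2))
      / real ((N + l) choose (l - t)) / (real N + real t)
    + falling_factorial (real N + 1) (l + 1)
         / ((real N - real t + 1) * fact (N + l) * falling_factorial (real l) t)
       * (\<Sum>\<nu>=0..l - t. fact (N + l - \<nu> - 1) * falling_factorial (real N - 1) \<nu>
            / (fact (l - t - \<nu>) * falling_factorial (real N - real t) \<nu>))"

lemma closed_form_eq:
  assumes "t \<ge> 1" "t \<le> l" "l \<le> N"
  shows "closed_form N t l = (-1) ^ (N + l) * real (int_binomial (N - 1) (int t - 2))
      / real ((N + l) choose (l - t)) / (real N + real t)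
    + fact (N + 1) * fact (l - t) * fact (N - 1)
      / (fact (N - l) * fact l * fact (N - t + 1) * fact (N + l)) * pos_sum N t l"
proof -
  have "falling_factorial (real N + 1) (l + 1) = fact (N + 1) / fact (N - l)"
    using falling_factorial_nat[of "l + 1" "N + 1"] assms by (simp add: add.commute)
  moreover have "falling_factorial (real l) t = fact l / fact (l - t)"
    using assms by (simp add: falling_factorial_nat)
  moreover have "(\<Sum>\<nu>=0..l - t. fact (N + l - \<nu> - 1) * falling_factorial (real N - 1) \<nu>
            / (fact (l - t - \<nu>) * falling_factorial (real N - real t) \<nu>))
      = fact (N - 1) / fact (N - t) * pos_sum N t l"
    unfolding pos_sum_def sum_distrib_left atMost_atLeast0
  proof (rule sum.cong[OF refl])
    fix \<nu> assume v: "\<nu> \<in> {0..l - t}"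
    have "falling_factorial (real N - 1) \<nu> = fact (N - 1) / fact (N - 1 - \<nu>)"
      using falling_factorial_nat[of \<nu> "N - 1"] v assms by (simp add: of_nat_diff)
    moreover have "falling_factorial (real N - real t) \<nu> = fact (N - t) / fact (N - t - \<nu>)"
      using falling_factorial_nat[of \<nu> "N - t"] v assms by (simp add: of_nat_diff)
    ultimately show "fact (N + l - \<nu> - 1) * falling_factorial (real N - 1) \<nu>
            / (fact (l - t - \<nu>) * falling_factorial (real N - real t) \<nu>)
        = fact (N - 1) / fact (N - t) * (fact (N + l - \<nu> - 1) * fact (N - t - \<nu>)
            / (fact (N - 1 - \<nu>) * fact (l - t - \<nu>)))" by (simp add: mult_ac)
  qed
  moreover have "(fact (N - t + 1) :: real) = (real N - real t + 1) * fact (N - t)"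
    using assms by (simp add: of_nat_diff algebra_simps)
  moreover have "(A / B) / (r * F * (L / E)) * (P / Q * S) = A * E * P / (B * L * (r * Q) * F) * S"
    for A B r F L E P Q S :: real by (simp add: mult_ac)
  ultimately show ?thesis unfolding closed_form_def by (simp only:)
qed

text \<open>This is \<open>alt_sum_rec\<close> read at n = N - l - 1. The alternating part solves
  the homogeneous equation, by absorption and the change of sign, and the part with
  \<open>pos_sum\<close> yields the right-hand side.\<close>

lemma closed_form_rec:
  assumes "t \<ge> 1" "t \<le> l" "l < N"
  shows "(real l - real t + 1) * closed_form N t l + (real N + real l + 1) * closed_form N t (Suc l)
    = real ((N + 1) choose Suc l)"
proof -
  obtain k where k: "l = t + k" using assms by (metis le_Suc_ex)
  obtain d where d: "N = Suc (l + d)" using assms less_imp_Suc_add by blast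
  define B :: real where "B = (-1) ^ (N + l) * real (int_binomial (N - 1) (int t - 2)) / (real N + real t)"
  define K :: real where "K = fact (N + 1) * fact (N - 1) / fact (N - t + 1)"
  have "Suc k * ((N + Suc l) choose Suc k) = (N + Suc l) * ((N + l) choose k)"
    using Suc_times_binomial_eq[of "N + l" k] by simp
  then have "real (Suc k) * real ((N + Suc l) choose Suc k) = real (N + Suc l) * real ((N + l) choose k)"
    by (metis of_nat_mult)
  moreover have "C' \<noteq> 0 \<Longrightarrow> C \<noteq> 0 \<Longrightarrow> a * C' = b * C \<Longrightarrow> a / C - b / C' = 0" for a b C C' :: real
    by (simp add: frac_eq_eq)
  moreover have "real ((N + l) choose k) \<noteq> 0" "real ((N + Suc l) choose Suc k) \<noteq> 0"
    using k by (simp_all del: binomial_Suc_Suc)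
  moreover have "real l - real t + 1 = real (Suc k)" "real N + real l + 1 = real (N + Suc l)"
    "l - t = k" "Suc l - t = Suc k" using k by simp_all
  ultimately have hom: "(real l - real t + 1) / real ((N + l) choose (l - t))
      - (real N + real l + 1) / real ((N + Suc l) choose (Suc l - t)) = 0"
    by (simp only:)
  have e: "l - t = k" "N - l = Suc d" "Suc l - t = Suc k" "N - Suc l = d" using k d by simp_all
  have rearrange: "a / c / s + A * E * P / (D * L * Q * F) * S = a / s / c + A * P / Q * E / (D * L * F) * S"
    for a c s A E P D L Q F S :: real by (simp add: mult_ac)
  have cf: "closed_form N t l = B / real ((N + l) choose (l - t))
      + K * fact k / (fact (Suc d) * fact l * fact (N + l)) * pos_sum N t l"
    using closed_form_eq[of t l N] assms unfolding e B_def K_def rearrange by simp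
  have "(-1) ^ (N + Suc l) = - ((-1) ^ (N + l) :: real)" "N + Suc l = Suc (N + l)" by simp_all
  then have cf': "closed_form N t (Suc l) = - B / real ((N + Suc l) choose (Suc l - t))
      + K * fact (Suc k) / (fact d * fact (Suc l) * fact (Suc (N + l))) * pos_sum N t (Suc l)"
    using closed_form_eq[of t "Suc l" N] assms unfolding e B_def K_def rearrange by simp
  have "(real l - real t + 1) * closed_form N t l + (real N + real l + 1) * closed_form N t (Suc l)
     = B * ((real l - real t + 1) / real ((N + l) choose (l - t))
      - (real N + real l + 1) / real ((N + Suc l) choose (Suc l - t)))
      + K * fact (Suc k) / (fact (Suc d) * fact (Suc l) * fact (N + l))
        * ((real N - real l) * pos_sum N t (Suc l) + (real l + 1) * pos_sum N t l)"
  proof -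
    have 1: "(real l - real t + 1) * (K * fact k / (fact (Suc d) * fact l * fact (N + l)))
        = K * fact (Suc k) / (fact (Suc d) * fact (Suc l) * fact (N + l)) * (real l + 1)"
      using k by (simp add: divide_simps) (simp add: algebra_simps)
    have 2: "(real N + real l + 1) * (K * fact (Suc k) / (fact d * fact (Suc l) * fact (Suc (N + l))))
        = K * fact (Suc k) / (fact (Suc d) * fact (Suc l) * fact (N + l)) * (real N - real l)"
    proof -
      have "real N - real l = real (Suc d)" using d by simp
      moreover have "(fact (Suc (N + l)) :: real) = (real N + real l + 1) * fact (N + l)"
        by (simp add: algebra_simps)
      moreover have "(fact (Suc d) :: real) = real (Suc d) * fact d" by simp
      moreover have "real N + real l + 1 \<noteq> 0" "real (Suc d) \<noteq> 0" by linarith+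
      ultimately show ?thesis by (simp add: divide_simps)
    qed
    show ?thesis unfolding cf cf' distrib_left
      by (simp only: 1[symmetric] 2[symmetric] mult.assoc[symmetric]) (simp add: algebra_simps)
  qed
  also have "\<dots> = K * fact (Suc k) / (fact (Suc d) * fact (Suc l) * fact (N + l))
      * (fact (N + l) * fact (N - t + 1) / (fact (N - 1) * fact (Suc l - t)))"
    unfolding hom pos_sum_rec[OF assms] by simp
  also have "\<dots> = fact (N + 1) / (fact (Suc l) * fact (N + 1 - Suc l))"
    using k d by (simp add: K_def)
  also have "\<dots> = real ((N + 1) choose Suc l)"
    using assms binomial_fact[of "Suc l" "N + 1", where 'a=real] by simp
  finally show ?thesis .
qed

text \<open>Induction on \<open>l\<close> from \<open>t\<close>, that is downwards in the index N -
  l. The base value comes from \<open>alt_sum_last\<close>, and each next value is determined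
  because its coefficient N + l + 1 is nonzero.\<close>

lemma alt_sum_eq_closed_form:
  assumes "t \<ge> 1" "t \<le> l" "l \<le> N"
  shows "alt_sum N t (N - l) = closed_form N t l"
  using assms(2,3)
proof (induction l rule: dec_induct)
  case base
  have nz: "real N + real t \<noteq> 0" using assms by simp
  have "pos_sum N t t = fact (N + t - 1) * fact (N - t) / fact (N - 1)"
    by (simp add: pos_sum_def)
  moreover have "(fact (N + t) :: real) = (real N + real t) * fact (N + t - 1)"
    using assms fact_reduce[of "N + t", where 'a=real] by simp
  moreover have "real ((N + 1) choose t) = fact (N + 1) / (fact t * fact (N - t + 1))"
    using base binomial_fact[of t "N + 1", where 'a=real] by (simp add: Suc_diff_le)
  moreover have "a * 1 * b / (c * d * e * (s * F)) * (F * c / b) = a / (d * e) / s"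
    if "b \<noteq> 0" "c \<noteq> 0" "F \<noteq> 0" for a b c d e s F :: real
    using that by simp
  ultimately have "fact (N + 1) * fact (t - t) * fact (N - 1)
      / (fact (N - t) * fact t * fact (N - t + 1) * fact (N + t)) * pos_sum N t t
      = real ((N + 1) choose t) / (real N + real t)"
    by (simp only: diff_self_eq_0 fact_0 fact_nonzero not_False_eq_True)
  then have "closed_form N t t = (real ((N + 1) choose t)
      + (-1) ^ (N + t) * real (int_binomial (N - 1) (int t - 2))) / (real N + real t)"
    using closed_form_eq[of t t N] assms base by (simp add: add_divide_distrib)
  then have "(real N + real t) * closed_form N t t = (real N + real t) * alt_sum N t (N - t)"
    using assms base nz alt_sum_last[of t N] by simp
  then show ?case using nz by simp
next
  case (step l)
  have lN: "l < N" and IH: "alt_sum N t (N - l) = closed_form N t l" using step by simp_all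
  define n where "n = N - Suc l"
  have n: "N - l = Suc n" "real n = real N - real l - 1" using step by (auto simp: n_def)
  have "(N + 1) choose Suc n = (N + 1) choose Suc l"
    using step binomial_symmetric[of "Suc l" "N + 1"] by (simp add: n_def Suc_diff_Suc)
  then have "(real l - real t + 1) * alt_sum N t (N - l) + (real N + real l + 1) * alt_sum N t n
      = real ((N + 1) choose Suc l)"
    using alt_sum_rec[of t n N] step assms n by (simp add: n_def algebra_simps)
  then have "(real N + real l + 1) * alt_sum N t n = (real N + real l + 1) * closed_form N t (Suc l)"
    unfolding IH using closed_form_rec[OF assms(1) step.hyps(1) lN] by linarith
  moreover have "real N + real l + 1 \<noteq> 0" by linarith
  ultimately show ?case by (simp add: n_def)
qed

section \<open>Separation probability\<close>

text \<open>An invariant colouring is constant on orbits, so it is an independent choice of one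
  colour per orbit, restricted by the points of \<open>A\<close> in it.\<close>

lemma card_invariant_colourings:
  assumes \<sigma>: "\<sigma> permutes X" and X: "finite X" "A \<subseteq> X"
  shows "card {c \<in> X \<rightarrow>\<^sub>E K. (\<forall>x\<in>A. c x = c\<^sub>0 x) \<and> (\<forall>x\<in>X. c (\<sigma> x) = c x)}
    = (\<Prod>u\<in>orbit \<sigma> ` X. card {v \<in> K. \<forall>x\<in>A \<inter> u. c\<^sub>0 x = v})"
    (is "card ?C = _")
proof -
  let ?O = "orbit \<sigma> ` X" and ?B = "\<lambda>u. {v \<in> K. \<forall>x\<in>A \<inter> u. c\<^sub>0 x = v}"
  have perm: "permutation \<sigma>" using \<sigma> X permutation_permutes by blast
  have self: "x \<in> orbit \<sigma> x" for x by (rule permutation_self_in_orbit[OF perm])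
  have sub: "orbit \<sigma> x \<subseteq> X" if "x \<in> X" for x by (rule permutes_orbit_subset[OF \<sigma> that])
  have orbit_eq: "orbit \<sigma> y = orbit \<sigma> x" if "y \<in> orbit \<sigma> x" for x y
    using cyclic_on_orbit'[OF perm, of x] that by (rule orbit_cyclic_eq3)
  have "bij_betw (\<lambda>b. \<lambda>x\<in>X. b (orbit \<sigma> x)) (Pi\<^sub>E ?O ?B) ?C"
  proof (rule bij_betwI')
    fix b b' assume b: "b \<in> Pi\<^sub>E ?O ?B" "b' \<in> Pi\<^sub>E ?O ?B"
    show "((\<lambda>x\<in>X. b (orbit \<sigma> x)) = (\<lambda>x\<in>X. b' (orbit \<sigma> x))) \<longleftrightarrow> b = b'"
    proof
      assume e: "(\<lambda>x\<in>X. b (orbit \<sigma> x)) = (\<lambda>x\<in>X. b' (orbit \<sigma> x))"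
      have "b (orbit \<sigma> x) = b' (orbit \<sigma> x)" if "x \<in> X" for x using fun_cong[OF e, of x] that by simp
      then show "b = b'" by (intro PiE_ext[OF b]) auto
    qed simp
  next
    fix b assume b: "b \<in> Pi\<^sub>E ?O ?B"
    have bo: "b (orbit \<sigma> x) \<in> K" "\<And>y. y \<in> A \<Longrightarrow> y \<in> orbit \<sigma> x \<Longrightarrow> c\<^sub>0 y = b (orbit \<sigma> x)"
      if "x \<in> X" for x using PiE_mem[OF b, of "orbit \<sigma> x"] that by auto
    have "\<sigma> x \<in> X" "orbit \<sigma> (\<sigma> x) = orbit \<sigma> x" if "x \<in> X" for x
      using permutes_in_image[OF \<sigma>] that permutation_orbit_step[OF perm] by auto
    then show "(\<lambda>x\<in>X. b (orbit \<sigma> x)) \<in> ?C" using bo X self by (auto simp: subset_iff)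
  next
    fix c assume c: "c \<in> ?C"
    have const: "c y = c x" if "y \<in> orbit \<sigma> x" "x \<in> X" for x y
      using that(1)
    proof induction
      case base
      then show ?case using c that(2) by blast
    next
      case (step y)
      then have "y \<in> X" using sub[OF that(2)] by blast
      then show ?case using c step by auto
    qed
    define b where "b = (\<lambda>u\<in>?O. c (SOME x. x \<in> u))"
    have b: "b (orbit \<sigma> x) = c x" if "x \<in> X" for x
    proof -
      have "(SOME y. y \<in> orbit \<sigma> x) \<in> orbit \<sigma> x" using self by (rule someI)
      then show ?thesis using that const by (simp add: b_def)
    qed
    have "b \<in> Pi\<^sub>E ?O ?B"
    proof (rule PiE_I)
      fix u assume "u \<in> ?O"
      then obtain x where x: "x \<in> X" "u = orbit \<sigma> x" by auto
      have "c\<^sub>0 y = c x" if "y \<in> A \<inter> u" for y using const[of y x] that x c by auto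
      then show "b u \<in> ?B u" using b x c by auto
    qed (simp add: b_def)
    moreover have "c = (\<lambda>x\<in>X. b (orbit \<sigma> x))"
      using c b by (auto simp: PiE_iff extensional_def fun_eq_iff)
    ultimately show "\<exists>b\<in>Pi\<^sub>E ?O ?B. c = (\<lambda>x\<in>X. b (orbit \<sigma> x))" by blast
  qed
  then have "card ?C = card (Pi\<^sub>E ?O ?B)" by (rule bij_betw_same_card[symmetric])
  also have "\<dots> = (\<Prod>u\<in>?O. card (?B u))" using X by (intro card_PiE) auto
  finally show ?thesis .
qed

definition monochromatic :: "('a \<Rightarrow> 'k) \<Rightarrow> 'a set \<Rightarrow> bool" where
  "monochromatic c U \<longleftrightarrow> (\<forall>x\<in>U. \<forall>y\<in>U. c x = c y)"

definition orbits_monochromatic :: "('a \<Rightarrow> 'k) \<Rightarrow> 'a set \<Rightarrow> 'a set \<Rightarrow> ('a \<Rightarrow> 'a) \<Rightarrow> bool" where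
  "orbits_monochromatic c\<^sub>0 A X \<sigma> \<longleftrightarrow> (\<forall>u\<in>orbit \<sigma> ` X. monochromatic c\<^sub>0 (A \<inter> u))"

text \<open>A polynomial in the number of colours: an orbit avoiding \<open>A\<close> takes any
  colour and gives the variable \<open>[:0, 1:]\<close>, one with a single prescribed colour gives
  1, and one with conflicting colours gives 0.\<close>

definition colouring_poly :: "('a \<Rightarrow> 'k) \<Rightarrow> 'a set \<Rightarrow> 'a set \<Rightarrow> ('a \<Rightarrow> 'a) \<Rightarrow> real poly" where
  "colouring_poly c\<^sub>0 A X \<sigma> = (\<Prod>u\<in>orbit \<sigma> ` X.
     if A \<inter> u = {} then [:0, 1:] else if monochromatic c\<^sub>0 (A \<inter> u) then 1 else 0)"

lemma poly_colouring_poly_card: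
  assumes \<sigma>: "\<sigma> permutes X" and X: "finite X" "A \<subseteq> X" and K: "finite K" "c\<^sub>0 ` A \<subseteq> K"
  shows "poly (colouring_poly c\<^sub>0 A X \<sigma>) (real (card K))
    = real (card {c \<in> X \<rightarrow>\<^sub>E K. (\<forall>x\<in>A. c x = c\<^sub>0 x) \<and> (\<forall>x\<in>X. c (\<sigma> x) = c x)})"
proof -
  have "poly (if A \<inter> u = {} then [:0, 1:] else if monochromatic c\<^sub>0 (A \<inter> u) then 1 else 0)
      (real (card K)) = real (card {v \<in> K. \<forall>x\<in>A \<inter> u. c\<^sub>0 x = v})" for u
  proof -
    consider "A \<inter> u = {}" | z where "z \<in> A \<inter> u" "monochromatic c\<^sub>0 (A \<inter> u)"
      | "A \<inter> u \<noteq> {}" "\<not> monochromatic c\<^sub>0 (A \<inter> u)" by blast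
    then show ?thesis
    proof cases
      case 1
      then show ?thesis by simp
    next
      case 2
      have "{v \<in> K. \<forall>x\<in>A \<inter> u. c\<^sub>0 x = v} = {c\<^sub>0 z}"
      proof (intro subset_antisym subsetI)
        fix v assume "v \<in> {v \<in> K. \<forall>x\<in>A \<inter> u. c\<^sub>0 x = v}"
        then have "c\<^sub>0 z = v" using 2(1) by blast
        then show "v \<in> {c\<^sub>0 z}" by simp
      next
        fix v assume "v \<in> {c\<^sub>0 z}"
        moreover have "c\<^sub>0 z \<in> K" using K(2) 2(1) by blast
        moreover have "\<forall>x\<in>A \<inter> u. c\<^sub>0 x = c\<^sub>0 z" using 2 unfolding monochromatic_def by blast
        ultimately show "v \<in> {v \<in> K. \<forall>x\<in>A \<inter> u. c\<^sub>0 x = v}" by (simp only: singleton_iff mem_Collect_eq simp_thms)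
      qed
      moreover have "A \<inter> u \<noteq> {}" using 2 by blast
      ultimately show ?thesis
        by (simp only: if_False if_P[OF 2(2)] poly_1) simp
    next
      case 3
      have "{v \<in> K. \<forall>x\<in>A \<inter> u. c\<^sub>0 x = v} = {}"
      proof (rule equals0I)
        fix v assume "v \<in> {v \<in> K. \<forall>x\<in>A \<inter> u. c\<^sub>0 x = v}"
        then have "c\<^sub>0 x = v" if "x \<in> A \<inter> u" for x using that by blast
        then show False using 3(2) unfolding monochromatic_def by metis
      qed
      then show ?thesis by (simp only: if_not_P[OF 3(1)] if_not_P[OF 3(2)] card.empty poly_0 of_nat_0)
    qed
  qed
  then show ?thesis
    unfolding card_invariant_colourings[OF \<sigma> X] colouring_poly_def by (simp add: poly_prod)
qed

text \<open>At 1 the free orbits also contribute 1, so only conflicts matter. This is a value of the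
  polynomial, in general not a number of colourings.\<close>

lemma poly_colouring_poly_1:
  assumes "finite X"
  shows "poly (colouring_poly c\<^sub>0 A X \<sigma>) 1 = (if orbits_monochromatic c\<^sub>0 A X \<sigma> then 1 else 0)"
proof (cases "orbits_monochromatic c\<^sub>0 A X \<sigma>")
  case True
  then show ?thesis unfolding colouring_poly_def poly_prod
    by (subst prod.neutral) (auto simp: orbits_monochromatic_def)
next
  case False
  then obtain u where u: "u \<in> orbit \<sigma> ` X" "\<not> monochromatic c\<^sub>0 (A \<inter> u)"
    unfolding orbits_monochromatic_def by blast
  then have "A \<inter> u \<noteq> {}" by (auto simp: monochromatic_def)
  then have "colouring_poly c\<^sub>0 A X \<sigma> = 0"
    unfolding colouring_poly_def using u assms by (intro prod_zero bexI[OF _ u(1)]) simp_all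
  then show ?thesis using False by simp
qed

text \<open>The bound \<open>n\<close> does not depend on \<open>B\<close>. For subsets of the q - t
  additional colours this gives a sum whose length is independent of q, as a polynomial in q
  requires.\<close>

lemma sum_over_subsets_by_card:
  fixes G :: "nat \<Rightarrow> real"
  assumes "finite B" and G: "\<And>m. m > n \<Longrightarrow> G m = 0"
  shows "(\<Sum>M\<in>Pow B. G (card M)) = (\<Sum>m\<le>n. real (card B choose m) * G m)"
proof -
  have "(\<Sum>M\<in>Pow B. G (card M)) = (\<Sum>m\<le>n + card B. \<Sum>M\<in>{M \<in> Pow B. card M = m}. G (card M))"
    using assms by (intro sum.group[symmetric]) (auto simp: trans_le_add2 card_mono)
  also have "\<dots> = (\<Sum>m\<le>n + card B. real (card B choose m) * G m)"
    using n_subsets[OF assms(1)] by (intro sum.cong refl) simp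
  also have "\<dots> = (\<Sum>m\<le>n. real (card B choose m) * G m)"
    using G by (intro sum.mono_neutral_right) auto
  finally show ?thesis .
qed

lemma poly_gbinomial_shift:
  fixes a x :: real
  shows "poly (smult (1 / fact m) (\<Prod>i = 0..<m. [:- a - real i, 1:])) x = (x - a) gchoose m"
  by (simp add: gbinomial_prod_rev poly_prod algebra_simps)

text \<open>Pairs and the colourings they preserve are counted in the other order, with the
  colourings grouped by the set \<open>M\<close> of colours above \<open>t\<close> that occur. The
  total of a group depends only on |M|.\<close>

lemma sum_invariant_colourings:
  fixes c\<^sub>0 :: "'a \<Rightarrow> nat"
  assumes X: "finite X" "X \<noteq> {}" "A \<subseteq> X" and c0: "c\<^sub>0 ` A = {1..t}" and t: "1 \<le> t" "t \<le> q"
  defines "L \<equiv> cycles_on X" and "N \<equiv> card X" and "l \<equiv> card A"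
  shows "(\<Sum>z\<in>L \<times> L. real (card {c \<in> X \<rightarrow>\<^sub>E {1..q}. (\<forall>x\<in>A. c x = c\<^sub>0 x)
      \<and> (\<forall>x\<in>X. c ((fst z \<circ> snd z) x) = c x)}))
    = fact (N - 1) * (\<Prod>k=1..t. fact (card (col_class c\<^sub>0 A k))) * fact (N - l)
      * (\<Sum>m\<le>N - l. real ((q - t) choose m) * (real ((N + t - 1) choose (N - l - m))
          / (real N + 1 - real t - real m)))"
proof -
  define C where "C = {c \<in> X \<rightarrow>\<^sub>E {1..q}. \<forall>x\<in>A. c x = c\<^sub>0 x}"
  have finA: "finite A" using X finite_subset by auto
  have finC: "finite C" unfolding C_def
    by (rule finite_subset[OF _ finite_PiE[of X "\<lambda>_. {1..q}"]]) (use X in auto)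
  have finL: "finite L" unfolding L_def using X(1) by (rule finite_cycles_on)
  have lN: "l \<le> N" unfolding l_def N_def using X by (intro card_mono) auto
  have tl: "t \<le> l" using card_image_le[OF finA, of c\<^sub>0] c0 by (simp add: l_def)
  have N: "N \<ge> 1" using X by (simp add: N_def card_gt_0_iff Suc_le_eq)
  define P where "P = (\<Prod>k=1..t. fact (card (col_class c\<^sub>0 A k)) :: real)"
  define G where "G m = fact (N - 1) * P * fact (N - l)
      * (real ((N + t - 1) choose (l + t + m - 1)) / (real N + 1 - real t - real m))" for m
  define h where "h c = real (card {z \<in> L \<times> L. \<forall>x\<in>X. c ((fst z \<circ> snd z) x) = c x})" for c :: "'a \<Rightarrow> nat"
  have h: "h c * (real N + 1 - real (card (c ` X)))
      = fact (N - 1) * (\<Prod>i\<in>c ` X. fact (card (col_class c X i)))" for c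
  proof -
    have "card {z \<in> L \<times> L. \<forall>x\<in>X. c ((fst z \<circ> snd z) x) = c x} * (N + 1 - card (c ` X))
      = fact (N - 1) * (\<Prod>i\<in>c ` X. fact (card (col_class c X i)))"
    proof -
      have "{z \<in> L \<times> L. \<forall>x\<in>X. c ((fst z \<circ> snd z) x) = c x}
        = {(p, q). p \<in> L \<and> q \<in> L \<and> (\<forall>x\<in>X. c (p (q x)) = c x)}" by auto
      then show ?thesis
        using card_cycle_pairs_colour_preserving[OF X(1,2), of c] by (simp add: L_def N_def)
    qed
    then have "h c * real (N + 1 - card (c ` X))
      = real (fact (N - 1) * (\<Prod>i\<in>c ` X. fact (card (col_class c X i))))"
      unfolding h_def of_nat_mult[symmetric] by (rule arg_cong[where f = real])
    moreover have "card (c ` X) \<le> N" unfolding N_def using X by (intro card_image_le)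
    ultimately show ?thesis by (simp add: of_nat_diff add.commute)
  qed
  have ext: "(\<Sum>c\<in>extensions c\<^sub>0 A {1..t} X M. h c) = G (card M)" if M: "M \<subseteq> {t<..q}" for M
  proof -
    let ?E = "extensions c\<^sub>0 A {1..t} X M"
    have finM: "finite M" using finite_subset[OF M] by simp
    have disj: "{1..t} \<inter> M = {}" using M by auto
    have cM: "card ({1..t} \<union> M) = t + card M" using disj finM by (subst card_Un_disjoint) auto
    have im: "c ` X = {1..t} \<union> M" if c: "c \<in> ?E" for c
    proof
      show "c ` X \<subseteq> {1..t} \<union> M" using c by (auto simp: extensions_def)
      have "c ` A = c\<^sub>0 ` A" using c by (intro image_cong) (auto simp: extensions_def)
      then have "{1..t} \<subseteq> c ` X" using image_mono[OF X(3), of c] c0 by simp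
      then show "{1..t} \<union> M \<subseteq> c ` X" using c unfolding extensions_def by blast
    qed
    have hE: "h c = fact (N - 1) / (real N + 1 - real t - real (card M))
        * real (\<Prod>i\<in>{1..t} \<union> M. fact (card (col_class c X i)))" if c: "c \<in> ?E" for c
    proof -
      \<comment> \<open>A colouring uses at most \<open>N\<close> colours, so the denominator is
        positive for every nonempty group.\<close>
      have "card (c ` X) \<le> N" unfolding N_def using X(1) by (rule card_image_le)
      then have "real N + 1 - real t - real (card M) \<noteq> 0" using im[OF c] cM by simp
      moreover have "h c * (real N + 1 - real t - real (card M))
          = fact (N - 1) * real (\<Prod>i\<in>{1..t} \<union> M. fact (card (col_class c X i)))"
        using h[of c] unfolding im[OF c] cM by (simp add: diff_diff_eq add.commute)
      ultimately show ?thesis by (simp add: field_simps)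
    qed
    have "(\<Sum>c\<in>?E. h c) = fact (N - 1) / (real N + 1 - real t - real (card M))
        * real (\<Sum>c\<in>?E. \<Prod>i\<in>{1..t} \<union> M. fact (card (col_class c X i)))"
      unfolding of_nat_sum sum_distrib_left by (rule sum.cong[OF refl hE])
    also have "(\<Sum>c\<in>?E. \<Prod>i\<in>{1..t} \<union> M. fact (card (col_class c X i)))
      = (\<Prod>k\<in>{1..t}. fact (card (col_class c\<^sub>0 A k))) * fact (card (X - A))
      * ((card (X - A) + card A + card {1..t} - 1) choose (card A + card {1..t} + card M - 1) :: nat)"
    proof -
      have "A \<union> (X - A) = X" using X(3) by auto
      then show ?thesis
        using sum_extensions[of A "X - A" "{1..t}" M c\<^sub>0] finA X(1) finM t c0 disj by simp
    qed
    also have "card (X - A) = N - l" unfolding N_def l_def using finA X(3) by (rule card_Diff_subset)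
    finally show ?thesis using lN by (simp add: G_def P_def l_def[symmetric])
  qed
  have "(\<Sum>z\<in>L \<times> L. card {c \<in> X \<rightarrow>\<^sub>E {1..q}. (\<forall>x\<in>A. c x = c\<^sub>0 x)
      \<and> (\<forall>x\<in>X. c ((fst z \<circ> snd z) x) = c x)})
    = (\<Sum>z\<in>L \<times> L. card {c \<in> C. \<forall>x\<in>X. c ((fst z \<circ> snd z) x) = c x})"
    by (intro sum.cong refl arg_cong[where f = card]) (auto simp: C_def)
  also have "\<dots> = (\<Sum>c\<in>C. card {z \<in> L \<times> L. \<forall>x\<in>X. c ((fst z \<circ> snd z) x) = c x})"
    by (rule sum_multicount_gen) (use finC finL in auto)
  finally have "(\<Sum>z\<in>L \<times> L. real (card {c \<in> X \<rightarrow>\<^sub>E {1..q}. (\<forall>x\<in>A. c x = c\<^sub>0 x)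
      \<and> (\<forall>x\<in>X. c ((fst z \<circ> snd z) x) = c x)})) = (\<Sum>c\<in>C. h c)"
    unfolding h_def of_nat_sum[symmetric] by (rule arg_cong[where f = real])
  also have "\<dots> = (\<Sum>M\<in>Pow {t<..q}. \<Sum>c\<in>{c \<in> C. c ` X - {1..t} = M}. h c)"
  proof (rule sum.group[symmetric])
    show "(\<lambda>c. c ` X - {1..t}) ` C \<subseteq> Pow {t<..q}"
    proof (intro image_subsetI PowI)
      fix c assume "c \<in> C"
      then have "c ` X \<subseteq> {1..q}" unfolding C_def by blast
      moreover have "{1..q} - {1..t} \<subseteq> {t<..q}" by auto
      ultimately show "c ` X - {1..t} \<subseteq> {t<..q}" by blast
    qed
  qed (use finC in auto)
  also have "\<dots> = (\<Sum>M\<in>Pow {t<..q}. G (card M))"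
  proof (rule sum.cong[OF refl])
    fix M assume M: "M \<in> Pow {t<..q}"
    have "{c \<in> C. c ` X - {1..t} = M} = extensions c\<^sub>0 A {1..t} X M"
    proof (intro subset_antisym subsetI)
      fix c assume c: "c \<in> {c \<in> C. c ` X - {1..t} = M}"
      then have "c ` X \<subseteq> {1..t} \<union> M" by blast
      then show "c \<in> extensions c\<^sub>0 A {1..t} X M"
        using c by (auto simp: extensions_def C_def PiE_iff)
    next
      fix c assume c: "c \<in> extensions c\<^sub>0 A {1..t} X M"
      then have s: "c ` X \<subseteq> {1..t} \<union> M" "M \<subseteq> c ` X" by (auto simp: extensions_def)
      moreover have "{1..t} \<union> M \<subseteq> {1..q}" using M t by auto
      moreover have "{1..t} \<inter> M = {}" using M by auto
      ultimately have "c ` X \<subseteq> {1..q}" "c ` X - {1..t} = M" by blast+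
      then show "c \<in> {c \<in> C. c ` X - {1..t} = M}"
        using c by (auto simp: extensions_def C_def PiE_iff)
    qed
    then show "(\<Sum>c\<in>{c \<in> C. c ` X - {1..t} = M}. h c) = G (card M)" using ext M by simp
  qed
  \<comment> \<open>For m > N - l the binomial in \<open>G\<close> vanishes.\<close>
  also have "\<dots> = (\<Sum>m\<le>N - l. real (card {t<..q} choose m) * G m)"
    using lN t by (intro sum_over_subsets_by_card) (auto simp: G_def binomial_eq_0)
  also have "\<dots> = fact (N - 1) * P * fact (N - l) * (\<Sum>m\<le>N - l. real ((q - t) choose m)
      * (real ((N + t - 1) choose (N - l - m)) / (real N + 1 - real t - real m)))"
    unfolding sum_distrib_left
  proof (rule sum.cong[OF refl])
    fix m assume m: "m \<in> {..N - l}"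
    have "(N + t - 1) choose (l + t + m - 1) = (N + t - 1) choose (N - l - m)"
    proof -
      have "N - l - m \<le> N + t - 1" "N + t - 1 - (N - l - m) = l + t + m - 1" using m lN t by auto
      then show ?thesis using binomial_symmetric[of "N - l - m" "N + t - 1"] by (simp only:)
    qed
    then show "real (card {t<..q} choose m) * G m = fact (N - 1) * P * fact (N - l) *
        (real ((q - t) choose m) * (real ((N + t - 1) choose (N - l - m)) / (real N + 1 - real t - real m)))"
      by (simp add: G_def)
  qed
  finally show ?thesis unfolding P_def .
qed

text \<open>The colouring polynomials summed over all pairs agree with an explicit polynomial at
  every integer q \<ge> t, hence everywhere. At 1 the former counts the conflict-free pairs and the
  latter gives \<open>alt_sum\<close>.\<close>

lemma card_monochromatic_pairs:
  fixes c\<^sub>0 :: "'a \<Rightarrow> nat"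
  assumes X: "finite X" "X \<noteq> {}" "A \<subseteq> X" and c0: "c\<^sub>0 ` A = {1..t}" and t: "1 \<le> t"
  shows "real (card {z \<in> cycles_on X \<times> cycles_on X. orbits_monochromatic c\<^sub>0 A X (fst z \<circ> snd z)})
    = fact (card X - 1) * (\<Prod>k=1..t. fact (card (col_class c\<^sub>0 A k))) * fact (card X - card A)
      * alt_sum (card X) t (card X - card A)"
proof -
  let ?L = "cycles_on X" and ?N = "card X" and ?n = "card X - card A"
  define F :: real where "F = fact (?N - 1) * (\<Prod>k=1..t. fact (card (col_class c\<^sub>0 A k))) * fact ?n"
  define e where "e m = real ((?N + t - 1) choose (?n - m)) / (real ?N + 1 - real t - real m)" for m
  have finL: "finite ?L" using X(1) by (rule finite_cycles_on)
  define B :: "nat \<Rightarrow> real poly"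
    where "B m = smult (1 / fact m) (\<Prod>i = 0..<m. [:- real t - real i, 1:])" for m
  have B: "poly (B m) x = (x - real t) gchoose m" for m x
    unfolding B_def by (rule poly_gbinomial_shift)
  define P where "P = (\<Sum>z\<in>?L \<times> ?L. colouring_poly c\<^sub>0 A X (fst z \<circ> snd z))"
  define Q where "Q = smult F (\<Sum>m\<le>?n. smult (e m) (B m))"
  have perm: "(fst z \<circ> snd z) permutes X" if "z \<in> ?L \<times> ?L" for z
  proof -
    have "fst z \<in> ?L" "snd z \<in> ?L" using that by (simp_all only: mem_Times_iff)
    then have "fst z permutes X" "snd z permutes X" by (simp_all only: cycles_on_def mem_Collect_eq)
    then show ?thesis by (intro permutes_compose)
  qed
  have "poly P (real q) = poly Q (real q)" if q: "t \<le> q" for q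
  proof -
    have "poly P (real q) = (\<Sum>z\<in>?L \<times> ?L. real (card {c \<in> X \<rightarrow>\<^sub>E {1..q}. (\<forall>x\<in>A. c x = c\<^sub>0 x)
      \<and> (\<forall>x\<in>X. c ((fst z \<circ> snd z) x) = c x)}))"
      unfolding P_def poly_sum
    proof (rule sum.cong[OF refl])
      fix z assume z: "z \<in> ?L \<times> ?L"
      have K: "card {1..q} = q" "c\<^sub>0 ` A \<subseteq> {1..q}" using c0 q by simp_all
      show "poly (colouring_poly c\<^sub>0 A X (fst z \<circ> snd z)) (real q)
        = real (card {c \<in> X \<rightarrow>\<^sub>E {1..q}. (\<forall>x\<in>A. c x = c\<^sub>0 x)
          \<and> (\<forall>x\<in>X. c ((fst z \<circ> snd z) x) = c x)})"
        by (rule poly_colouring_poly_card[OF perm[OF z] X(1,3) finite_atLeastAtMost K(2), unfolded K(1)])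
    qed
    also have "\<dots> = F * (\<Sum>m\<le>?n. real ((q - t) choose m) * e m)"
      unfolding F_def e_def by (rule sum_invariant_colourings[OF X c0 t q])
    also have "\<dots> = poly Q (real q)"
      using q by (simp add: Q_def poly_sum B binomial_gbinomial mult.commute)
    finally show ?thesis .
  qed
  then have "real ` {t..} \<subseteq> {x. poly (P - Q) x = 0}" by auto
  moreover have "infinite (real ` {t..})"
    by (subst finite_image_iff) (simp_all add: inj_on_def infinite_Ici)
  ultimately have "P - Q = 0" using poly_roots_finite[of "P - Q"] finite_subset by blast
  then have "poly P 1 = poly Q 1" by simp
  moreover have "poly P 1 = real (card {z \<in> ?L \<times> ?L. orbits_monochromatic c\<^sub>0 A X (fst z \<circ> snd z)})"
  proof -
    have "poly P 1 = (\<Sum>z\<in>?L \<times> ?L. if orbits_monochromatic c\<^sub>0 A X (fst z \<circ> snd z) then 1 else 0)"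
      by (simp only: P_def poly_sum poly_colouring_poly_1[OF X(1)])
    also have "\<dots> = (\<Sum>z\<in>{z \<in> ?L \<times> ?L. orbits_monochromatic c\<^sub>0 A X (fst z \<circ> snd z)}. 1)"
      by (rule sum.inter_filter[symmetric]) (use finL in blast)
    finally show ?thesis by simp
  qed
  moreover have "poly Q 1 = F * alt_sum ?N t ?n"
    by (simp add: Q_def poly_sum B alt_sum_def e_def mult.commute)
  ultimately show ?thesis unfolding F_def by simp
qed

section \<open>From counts to the probability\<close>

lemma pair_pmf_of_set:
  assumes "finite A" "A \<noteq> {}" "finite B" "B \<noteq> {}"
  shows "pair_pmf (pmf_of_set A) (pmf_of_set B) = pmf_of_set (A \<times> B)"
proof (rule pmf_eqI)
  fix z :: "'a \<times> 'b"
  obtain a b where z: "z = (a, b)" by (cases z)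
  show "pmf (pair_pmf (pmf_of_set A) (pmf_of_set B)) z = pmf (pmf_of_set (A \<times> B)) z"
    using assms by (simp add: z pmf_pair indicator_def card_cartesian_product)
qed

lemma separation_prob_eq_card:
  assumes "N \<ge> 1"
  shows "separation_prob N t S = real (card {z \<in> cycles_on {1..N} \<times> cycles_on {1..N}.
    separates N t S (fst z \<circ> snd z)}) / (fact (N - 1) * fact (N - 1))"
proof -
  let ?L = "cycles_on {1..N}"
  have L: "full_cycles N = ?L" by (simp add: full_cycles_def cycles_on_def)
  have fin: "finite ?L" by (rule finite_cycles_on) simp
  have card: "card ?L = fact (N - 1)" using card_cycles_on[of "{1..N}"] assms by simp
  then have ne: "?L \<noteq> {}" by (metis card.empty fact_nonzero)
  have "separation_prob N t S
      = measure_pmf.prob (pmf_of_set (?L \<times> ?L)) {(p, q). separates N t S (p \<circ> q)}"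
    using fin ne by (simp add: separation_prob_def L pair_pmf_of_set)
  also have "\<dots> = real (card ((?L \<times> ?L) \<inter> {(p, q). separates N t S (p \<circ> q)})) / real (card (?L \<times> ?L))"
    using fin ne by (intro measure_pmf_of_set) auto
  also have "(?L \<times> ?L) \<inter> {(p, q). separates N t S (p \<circ> q)}
      = {z \<in> ?L \<times> ?L. separates N t S (fst z \<circ> snd z)}" by auto
  finally show ?thesis by (simp only: card_cartesian_product card of_nat_mult of_nat_fact)
qed

text \<open>The colouring argument starts from at least one prescribed colour, so t = 0 is treated
  separately; separation is then vacuous.\<close>

lemma separation_prob_no_sets:
  assumes "N \<ge> 1"
  shows "separation_prob N 0 S = 1"
proof -
  let ?L = "cycles_on {1..N}"
  have "{z \<in> ?L \<times> ?L. separates N 0 S (fst z \<circ> snd z)} = ?L \<times> ?L"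
    by (simp add: separates_def)
  moreover have "card ?L = fact (N - 1)" using card_cycles_on[of "{1..N}"] assms by simp
  ultimately show ?thesis
    unfolding separation_prob_eq_card[OF assms] by (simp add: card_cartesian_product)
qed

theorem theorem5p5:
  fixes N t l :: nat and S :: "nat \<Rightarrow> nat set" and ls :: "nat \<Rightarrow> nat"
  assumes "N \<ge> 1"
    and "\<And>j. j \<in> {1..t} \<Longrightarrow> S j \<subseteq> {1..N}"
    and "\<And>j. j \<in> {1..t} \<Longrightarrow> S j \<noteq> {}"
    and "disjoint_family_on S {1..t}"
    and "\<And>j. j \<in> {1..t} \<Longrightarrow> card (S j) = ls j"
    and "l = (\<Sum>j=1..t. ls j)"
  shows "separation_prob N t S =
    fact (N - l) * (\<Prod>j=1..t. fact (ls j)) / (fact (N - 1) * (real N + real t)) *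
    ((-1) ^ (N + l) * real (int_binomial (N - 1) (int t - 2)) / real ((N + l) choose (l - t))
     + (real N + real t) * falling_factorial (real N + 1) (l + 1)
         / ((real N - real t + 1) * fact (N + l) * falling_factorial (real l) t)
       * (\<Sum>\<nu>=0..l - t. fact (N + l - \<nu> - 1) * falling_factorial (real N - 1) \<nu>
            / (fact (l - t - \<nu>) * falling_factorial (real N - real t) \<nu>)))"
proof (cases "t = 0")
  case True
  \<comment> \<open>For t = 0 the negative lower index makes the binomial zero, the sum has one
    term, and the remaining factors cancel to 1.\<close>
  then have l: "l = 0" using assms(6) by simp
  have "fact N = real N * fact (N - 1)" using assms(1) fact_reduce[of N, where 'a=real] by simp
  then show ?thesis
    using assms(1) separation_prob_no_sets[OF assms(1), of S] True l
    by (simp add: int_binomial_def falling_factorial_def)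
next
  case False
  then have t: "1 \<le> t" by simp
  define A where "A = (\<Union>j\<in>{1..t}. S j)"
  \<comment> \<open>Disjointness makes the index unique on \<open>A\<close>, and all that follows
    looks at \<open>A\<close> alone.\<close>
  define c\<^sub>0 where "c\<^sub>0 x = (THE j. j \<in> {1..t} \<and> x \<in> S j)" for x
  have finS: "finite (S j)" if "j \<in> {1..t}" for j
    using assms(2)[OF that] finite_subset by blast
  have c0: "c\<^sub>0 x = j" if "j \<in> {1..t}" "x \<in> S j" for x j
    unfolding c\<^sub>0_def
  proof (rule the_equality)
    fix i assume "i \<in> {1..t} \<and> x \<in> S i"
    then show "i = j" using disjoint_family_onD[OF assms(4), of i j] that by blast
  qed (use that in simp)
  have class_S: "col_class c\<^sub>0 A j = S j" if "j \<in> {1..t}" for j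
    using c0 that by (auto simp: A_def)
  have A: "A \<subseteq> {1..N}" unfolding A_def by (rule UN_least) (rule assms(2))
  have "c\<^sub>0 ` A = {1..t}"
  proof
    show "c\<^sub>0 ` A \<subseteq> {1..t}" using c0 by (auto simp: A_def)
    show "{1..t} \<subseteq> c\<^sub>0 ` A"
    proof
      fix j assume j: "j \<in> {1..t}"
      then obtain x where "x \<in> S j" using assms(3) by blast
      then show "j \<in> c\<^sub>0 ` A" using c0[OF j] j by (force simp: A_def)
    qed
  qed
  note c0_image = this
  have "card A = l"
    unfolding A_def assms(6) using assms(4,5) finS
    by (subst card_UN_disjoint') (auto simp: disjoint_family_on_def)
  note card_A = this
  \<comment> \<open>Every \<open>S j\<close> is nonempty, so all \<open>t\<close> colours occur on
    \<open>A\<close>.\<close>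
  have tl: "t \<le> l"
    using card_image_le[of A c\<^sub>0] finite_subset[OF A] by (simp add: c0_image card_A)
  have lN: "l \<le> N" using card_mono[OF _ A] by (simp add: card_A)
  have "separates N t S \<sigma> \<longleftrightarrow> orbits_monochromatic c\<^sub>0 A {1..N} \<sigma>" for \<sigma>
    unfolding separates_def orbits_monochromatic_def monochromatic_def
  proof (intro iffI ballI notI)
    fix u x y
    assume sep: "\<forall>x\<in>{1..N}. \<not> (\<exists>i\<in>{1..t}. \<exists>j\<in>{1..t}. i \<noteq> j \<and>
        orbit \<sigma> x \<inter> S i \<noteq> {} \<and> orbit \<sigma> x \<inter> S j \<noteq> {})"
      and u: "u \<in> orbit \<sigma> ` {1..N}" and xy: "x \<in> A \<inter> u" "y \<in> A \<inter> u"
    obtain i j where "i \<in> {1..t}" "x \<in> S i" "j \<in> {1..t}" "y \<in> S j"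
      using xy by (auto simp: A_def)
    then show "c\<^sub>0 x = c\<^sub>0 y" using c0 sep u xy by blast
  next
    fix x
    assume mono: "\<forall>u\<in>orbit \<sigma> ` {1..N}. \<forall>x\<in>A \<inter> u. \<forall>y\<in>A \<inter> u. c\<^sub>0 x = c\<^sub>0 y"
      and x: "x \<in> {1..N}" and "\<exists>i\<in>{1..t}. \<exists>j\<in>{1..t}. i \<noteq> j \<and>
        orbit \<sigma> x \<inter> S i \<noteq> {} \<and> orbit \<sigma> x \<inter> S j \<noteq> {}"
    then obtain i j y z where ij: "i \<in> {1..t}" "j \<in> {1..t}" "i \<noteq> j"
      "y \<in> orbit \<sigma> x" "y \<in> S i" "z \<in> orbit \<sigma> x" "z \<in> S j" by blast
    then have "y \<in> A" "z \<in> A" by (auto simp: A_def)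
    then have "c\<^sub>0 y = c\<^sub>0 z" using mono x ij by blast
    then show False using c0 ij by metis
  qed
  then have "separation_prob N t S = fact (N - 1) * (\<Prod>k=1..t. fact (card (col_class c\<^sub>0 A k)))
      * fact (N - l) * alt_sum N t (N - l) / (fact (N - 1) * fact (N - 1))"
    using card_monochromatic_pairs[of "{1..N}" A c\<^sub>0 t] assms(1) A c0_image t
    by (simp add: separation_prob_eq_card[OF assms(1)] card_A)
  also have "(\<Prod>k=1..t. fact (card (col_class c\<^sub>0 A k))) = (\<Prod>j=1..t. fact (ls j) :: real)"
    by (intro prod.cong refl) (simp only: class_S assms(5))
  also have "alt_sum N t (N - l) = closed_form N t l"
    by (rule alt_sum_eq_closed_form[OF t tl lN])
  finally have "separation_prob N t S = fact (N - l) * (\<Prod>j=1..t. fact (ls j)) / fact (N - 1) * closed_form N t l"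
    by simp
  \<comment> \<open>Moves the division by N + t from \<open>closed_form\<close> to the
    prefactor.\<close>
  moreover have "F * Q / G * (a / b / s + c / d * T) = F * Q / (G * s) * (a / b + s * c / d * T)"
    if "s \<noteq> 0" for F Q G a b s c d T :: real
  proof -
    have "s * (a / b / s + c / d * T) = a / b + s * c / d * T" using that by (simp add: distrib_left)
    moreover have "F * Q / (G * s) * (s * y) = F * Q / G * y" for y using that by simp
    ultimately show ?thesis by metis
  qed
  moreover have "real N + real t \<noteq> 0" using assms(1) by simp
  ultimately show ?thesis unfolding closed_form_def by (simp only: not_False_eq_True)
qed

end
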